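(* For any $\gamma\in(0,1)$ there exists an entire function $F$ of order exactly $\gamma^{-1}$ such that all its zeros $t_n$ are simple and lie in an angle of size $\pi\gamma$ (a set $\{\theta_0<\arg z<\theta_0+\pi\gamma\}$), and $$\sum_n\frac{1}{|F'(t_n)|}<\infty,\qquad \frac{1}{F(z)}=\sum_n\frac{1}{F'(t_n)(z-t_n)}.$$ *)

theory Defs
  imports "HOL-Analysis.Analysis"
begin

definition max_modulus :: "(complex \<Rightarrow> complex) \<Rightarrow> real \<Rightarrow> real" where
  "max_modulus F r = Sup ((\<lambda>z. norm (F z)) ` sphere 0 r)"

definition entire_order :: "(complex \<Rightarrow> complex) \<Rightarrow> ereal" where
  "entire_order F = Limsup at_top (\<lambda>r. ereal (ln (ln (max_modulus F r)) / ln r))"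

end

theory Submission
  imports Defs "HOL-Complex_Analysis.Complex_Analysis" "HOL-Real_Asymp.Real_Asymp"
begin

text \<open>
  Put \<open>E w = exp w / (w + 10)\<^sup>2\<close> on the right half-plane, and write \<open>z = w\<^sup>\<gamma>\<close>. The function \<open>1 + E w\<close>,
  transplanted to the \<open>z\<close>-plane, is defined only in the angle \<open>\<bar>arg z\<bar> < \<pi>\<gamma>/2\<close>. On a vertical line
  \<open>Re w = c\<close> with small \<open>c\<close>, however, \<open>ln (1 + E w)\<close> is \<open>O(\<bar>w\<bar>\<^sup>-\<^sup>2)\<close>, so the Cauchy integral \<open>G\<^sub>c z\<close> of
  this density over the image of the line is bounded, and it jumps by \<open>ln (1 + E w)\<close> across the curve.
  Hence the function equal to \<open>exp G\<^sub>c\<close> to the left of the curve and to \<open>exp G\<^sub>c \<cdot> (1 + E)\<close> to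
  its right is entire; up to bounded factors it is \<open>1\<close> outside and \<open>1 + E\<close> inside the angle, and its
  zeros are the points \<open>w\<^sup>\<gamma>\<close> with \<open>E w = -1\<close>. Multiplying it by a polynomial of large degree with
  positive simple zeros makes \<open>\<Sum> 1 / \<bar>F'(t)\<bar>\<close> converge and lets \<open>\<bar>F\<bar>\<close> tend to infinity on the circles
  \<open>\<bar>z\<bar> = ((2k+1)\<pi>)\<^sup>\<gamma>\<close>; the residue theorem then gives the expansion of \<open>1 / F\<close>.
\<close>

section \<open>Cauchy integrals along segments\<close>

text \<open>Differentiation under the integral sign. It is carried out on balls because
  \<open>leibniz_rule_holomorphic\<close> asks for a convex domain; analyticity is local, so this
  covers every open \<open>U\<close>.\<close>

lemma contour_integral_linepath_cauchy_kernel_holomorphic: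
  fixes h p :: "complex \<Rightarrow> complex"
  assumes U: "open U"
    and h: "continuous_on (closed_segment a b) h" and p: "continuous_on (closed_segment a b) p"
    and ne: "\<And>z w. z \<in> U \<Longrightarrow> w \<in> closed_segment a b \<Longrightarrow> p w \<noteq> z"
  shows "(\<lambda>z. contour_integral (linepath a b) (\<lambda>w. h w / (p w - z))) holomorphic_on U"
proof -
  have lin: "linepath a b t \<in> closed_segment a b" if "t \<in> {0..1}" for t
    using that by (metis image_eqI linepath_image_01)
  have cont: "continuous_on {0..1} (\<lambda>t. q (linepath a b t))"
    if "continuous_on (closed_segment a b) q" for q :: "complex \<Rightarrow> complex"
    by (rule continuous_on_compose2[OF that]) (use lin in \<open>auto intro: continuous_intros\<close>)
  have loc: "(\<lambda>z. contour_integral (linepath a b) (\<lambda>w. h w / (p w - z))) holomorphic_on ball z0 r"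
    if B: "ball z0 r \<subseteq> U" for z0 r
  proof -
    let ?L = "linepath a b"
    have c1: "continuous_on (S \<times> {0..1::real}) (\<lambda>y. q (linepath a b (snd y)))"
      if "continuous_on (closed_segment a b) q" for q :: "complex \<Rightarrow> complex" and S :: "complex set"
      using continuous_on_compose2[OF cont[OF that] continuous_on_snd[OF continuous_on_id], of "S \<times> {0..1}"]
      by auto
    have c2: "continuous_on (ball z0 r \<times> {0..1})
       (\<lambda>y. h (?L (snd y)) * (b - a) / (p (?L (snd y)) - fst y)\<^sup>2)"
      by (intro continuous_intros c1 h p) (use ne lin B in force)
    have "(\<lambda>z. integral (cbox 0 1) (\<lambda>t. h (?L t) * (b - a) / (p (?L t) - z))) holomorphic_on ball z0 r"
    proof (rule leibniz_rule_holomorphic[where fx = "\<lambda>z t. h (?L t) * (b - a) / (p (?L t) - z)\<^sup>2"])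
      fix z and t :: real assume z: "z \<in> ball z0 r" and t: "t \<in> cbox 0 1"
      then have "p (?L t) \<noteq> z" using ne[of z "?L t"] lin[of t] B by (auto simp: cbox_interval)
      then show "((\<lambda>x. h (?L t) * (b - a) / (p (?L t) - x)) has_field_derivative
            h (?L t) * (b - a) / (p (?L t) - z)\<^sup>2) (at z within ball z0 r)"
        by (auto intro!: derivative_eq_intros simp: power2_eq_square)
    next
      fix z assume z: "z \<in> ball z0 r"
      show "(\<lambda>t. h (?L t) * (b - a) / (p (?L t) - z)) integrable_on cbox 0 1"
        by (rule integrable_continuous)
          (use z ne lin B in \<open>force simp: cbox_interval intro!: continuous_intros cont h p\<close>)
    next
      show "continuous_on (ball z0 r \<times> cbox 0 1) (\<lambda>(x, t). h (?L t) * (b - a) / (p (?L t) - x)\<^sup>2)"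
        using c2 by (simp add: case_prod_unfold cbox_interval)
    qed auto
    moreover have "contour_integral ?L (\<lambda>w. h w / (p w - z))
        = integral (cbox 0 1) (\<lambda>t. h (?L t) * (b - a) / (p (?L t) - z))" for z
      by (simp add: contour_integral_integral cbox_interval)
    ultimately show ?thesis by simp
  qed
  show ?thesis
  proof (rule analytic_imp_holomorphic)
    show "(\<lambda>z. contour_integral (linepath a b) (\<lambda>w. h w / (p w - z))) analytic_on U"
      unfolding analytic_on_def using U loc by (meson openE)
  qed
qed

lemma summable_inverse_Suc_squares: "summable (\<lambda>n. C / (real n + 1)\<^sup>2)"
proof -
  have "summable (\<lambda>n. inverse (real (Suc n) ^ 2))"
    by (subst summable_Suc_iff) (rule inverse_power_summable, simp)
  then have "summable (\<lambda>n. C * inverse (real (Suc n) ^ 2))" by (rule summable_mult)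
  then show ?thesis by (simp add: field_simps)
qed

section \<open>The density on the right half-plane\<close>

text \<open>The exponent 2 makes the factor decay integrably along vertical lines. The shift 10
  keeps the pole out of the right half-plane and makes the modulus less than 1/2 on the strip
  \<open>0 \<le> Re w \<le> 3\<close> (exp 3 is at most 27 and the denominator at least 100), so the
  principal logarithm of \<open>1 + expfac w\<close> is holomorphic there.\<close>

definition expfac :: "complex \<Rightarrow> complex" where "expfac w = exp w / (w + 10)\<^sup>2"

definition logfac :: "complex \<Rightarrow> complex" where "logfac w = Ln (1 + expfac w)"

lemma norm_add_10_ge: "Re w \<ge> 0 \<Longrightarrow> norm (w + 10) \<ge> norm w" "Re w \<ge> 0 \<Longrightarrow> norm (w + 10) \<ge> 10"
  "Re w \<ge> 0 \<Longrightarrow> w + 10 \<noteq> 0"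
proof -
  assume w: "Re w \<ge> 0"
  show "norm (w + 10) \<ge> norm w"
    unfolding cmod_def using w by (intro real_sqrt_le_mono) (auto intro!: power_mono)
  show 1: "norm (w + 10) \<ge> 10"
    using complex_Re_le_cmod[of "w + 10"] w by simp
  then show "w + 10 \<noteq> 0" by force
qed

lemma norm_expfac: "norm (expfac w) = exp (Re w) / (norm (w + 10))\<^sup>2"
  by (simp add: expfac_def norm_divide norm_power)

lemma norm_expfac_le:
  assumes "0 \<le> Re w" "Re w \<le> 3"
  shows "norm (expfac w) \<le> 27 / (norm (w + 10))\<^sup>2"
proof -
  have "exp (Re w) \<le> exp 3" using assms by simp
  also have "exp (3::real) = exp 1 ^ 3" by (simp flip: exp_of_nat_mult)
  also have "\<dots> \<le> 3 ^ 3" by (intro power_mono exp_le) auto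
  finally show ?thesis by (simp add: norm_expfac divide_right_mono)
qed

lemma norm_expfac_less:
  assumes "0 \<le> Re w" "Re w \<le> 3"
  shows "norm (expfac w) < 1/2"
proof -
  have "(norm (w + 10))\<^sup>2 \<ge> 10\<^sup>2" using norm_add_10_ge(2)[OF assms(1)] by (intro power_mono) auto
  then have "27 / (norm (w + 10))\<^sup>2 \<le> 27 / 100" by (intro divide_left_mono) auto
  then show ?thesis using norm_expfac_le[OF assms] by linarith
qed

lemma norm_logfac_le:
  assumes "0 \<le> Re w" "Re w \<le> 3"
  shows "norm (logfac w) \<le> 54 / (norm (w + 10))\<^sup>2"
  using norm_Ln_le[OF norm_expfac_less[OF assms]] norm_expfac_le[OF assms] by (simp add: logfac_def)

text \<open>Provides the summable majorant for the unit pieces of a vertical line. Both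
  \<open>n\<close> and 1 are at most \<open>norm (w + 10)\<close>, so \<open>n + 1\<close> is at
  most twice this norm, and 216 = 4 * 54.\<close>

lemma norm_logfac_Im_le:
  assumes "0 \<le> Re w" "Re w \<le> 3" "real n \<le> \<bar>Im w\<bar>"
  shows "norm (logfac w) \<le> 216 / (real n + 1)\<^sup>2"
proof -
  have "real n \<le> norm (w + 10)" using abs_Im_le_cmod[of "w + 10"] assms(3) by simp
  with norm_add_10_ge(2)[OF assms(1)] have "real n + 1 \<le> 2 * norm (w + 10)" by linarith
  then have "(real n + 1)\<^sup>2 \<le> (2 * norm (w + 10))\<^sup>2" by (intro power_mono) auto
  then have "54 / (norm (w + 10))\<^sup>2 \<le> 216 / (real n + 1)\<^sup>2"
    using norm_add_10_ge(3)[OF assms(1)] by (simp add: field_simps add_nonneg_eq_0_iff)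
  then show ?thesis using norm_logfac_le[OF assms(1,2)] by linarith
qed

lemma one_plus_expfac_not_nonpos:
  assumes "0 \<le> Re w" "Re w \<le> 3"
  shows "1 + expfac w \<notin> \<real>\<^sub>\<le>\<^sub>0"
  using norm_expfac_less[OF assms] abs_Re_le_cmod[of "expfac w"] by (auto simp: complex_nonpos_Reals_iff)

lemma exp_logfac: "0 \<le> Re w \<Longrightarrow> Re w \<le> 3 \<Longrightarrow> exp (logfac w) = 1 + expfac w"
  using one_plus_expfac_not_nonpos[of w] unfolding logfac_def by (subst exp_Ln) auto

lemma holomorphic_on_expfac [holomorphic_intros]: "S \<subseteq> {w. Re w \<ge> 0} \<Longrightarrow> expfac holomorphic_on S"
  unfolding expfac_def[abs_def] using norm_add_10_ge(3) by (intro holomorphic_intros) auto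

lemma holomorphic_on_logfac: "logfac holomorphic_on {w. 0 \<le> Re w \<and> Re w \<le> 3}"
  unfolding logfac_def[abs_def] using one_plus_expfac_not_nonpos
  by (intro holomorphic_intros holomorphic_on_Ln) auto

text \<open>The bound 3/2 matches the curve along which the entire function is glued. It loses no
  zero in the closed right half-plane, since the modulus of \<open>expfac\<close> is below 1/2 for
  \<open>0 \<le> Re u \<le> 3\<close>.\<close>

definition expfac_zeros :: "complex set" where
  "expfac_zeros = {u. Re u > 3/2 \<and> 1 + expfac u = 0}"

text \<open>The small Lipschitz constant makes \<open>u - 2 * Ln (u + 10)\<close> a perturbation of
  the identity by a contraction, hence injective on the half-plane. It also bounds the growth of the
  logarithm.\<close>

lemma norm_Ln_add_10_diff_le:
  assumes "Re u \<ge> 0" "Re v \<ge> 0"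
  shows "norm (Ln (u + 10) - Ln (v + 10)) \<le> 1 / 10 * norm (u - v)"
proof (rule field_differentiable_bound[where S = "{w. Re w \<ge> 0}"])
  show "convex {w. Re w \<ge> 0}" by (rule convex_halfspace_Re_ge)
  fix w :: complex assume w: "w \<in> {w. Re w \<ge> 0}"
  then have "w + 10 \<notin> \<real>\<^sub>\<le>\<^sub>0" by (auto simp: complex_nonpos_Reals_iff)
  then show "((\<lambda>w. Ln (w + 10)) has_field_derivative inverse (w + 10)) (at w within {w. Re w \<ge> 0})"
    by (auto intro!: derivative_eq_intros simp: field_simps)
  show "norm (inverse (w + 10)) \<le> 1 / 10"
    using norm_add_10_ge(2)[of w] w le_imp_inverse_le[of 10 "norm (w + 10)"]
    by (simp only: norm_inverse) (simp add: field_simps)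
qed (use assms in auto)

lemma expfac_eq_exp: "Re u \<ge> 0 \<Longrightarrow> expfac u = exp (u - 2 * Ln (u + 10))"
  using norm_add_10_ge(3)[of u] by (simp add: expfac_def exp_diff exp_double)

text \<open>Writing \<open>expfac = exp \<circ> \<phi>\<close>, a zero satisfies
  \<open>\<phi> u = (2 * N u + 1) * pi * \<i>\<close> for an integer \<open>N u\<close>. As
  \<open>\<phi>\<close> is injective, this integer labels the zeros, and
  \<open>norm (\<phi> u) \<le> 20 * norm u\<close> forces \<open>norm u\<close> to grow at least
  linearly in the label. \<open>int_encode\<close> turns the label into a natural number, so that
  the sum is dominated by a series over the squares.\<close>

lemma summable_on_expfac_zeros: "(\<lambda>u. 1 / (norm u)\<^sup>2) summable_on expfac_zeros"
proof -
  define \<phi> where "\<phi> u = u - 2 * Ln (u + 10)" for u :: complex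
  have "\<exists>n. \<phi> u = \<i> * pi + of_int (2 * n) * of_real pi * \<i>" if "u \<in> expfac_zeros" for u
  proof -
    have "exp (\<phi> u) = exp (\<i> * pi)"
      using that expfac_eq_exp[of u] by (simp add: expfac_zeros_def \<phi>_def add_eq_0_iff)
    then show ?thesis by (simp only: exp_eq of_real_mult of_real_of_int_eq)
  qed
  then obtain N where N: "\<phi> u = \<i> * pi + of_int (2 * N u) * of_real pi * \<i>" if "u \<in> expfac_zeros" for u
    by metis
  have inj: "inj_on (\<lambda>u. int_encode (N u)) expfac_zeros"
  proof (rule inj_onI)
    fix u v assume uv: "u \<in> expfac_zeros" "v \<in> expfac_zeros" "int_encode (N u) = int_encode (N v)"
    then have "N u = N v" using inj_int_encode by (meson inj_onD UNIV_I)
    then have "\<phi> u = \<phi> v" using N uv(1,2) by simp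
    then have "u - v = 2 * (Ln (u + 10) - Ln (v + 10))" by (simp add: \<phi>_def algebra_simps)
    then have "norm (u - v) = 2 * norm (Ln (u + 10) - Ln (v + 10))"
      by (simp only: norm_mult) simp
    then have "norm (u - v) \<le> 2 * (1 / 10 * norm (u - v))"
      using norm_Ln_add_10_diff_le[of u v] uv by (simp add: expfac_zeros_def)
    then show "u = v" by simp
  qed
  \<comment> \<open>1600 = 40 * 40: the label plus one is at most twice the odd number
    \<open>2 * N u + 1\<close> in absolute value, hence at most \<open>2 * norm (\<phi> u)\<close>,
    which is at most \<open>40 * norm u\<close>.\<close>
  have bound: "1 / (norm u)\<^sup>2 \<le> 1600 / (real (int_encode (N u)) + 1)\<^sup>2" if u: "u \<in> expfac_zeros" for u
  proof -
    have Re: "Re u > 3/2" using u by (simp add: expfac_zeros_def)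
    then have n1: "norm u \<ge> 1" using complex_Re_le_cmod[of u] by linarith
    have "norm (Ln 10 :: complex) \<le> 9"
      using Ln_of_real[of 10] ln_le_minus_one[of 10] ln_ge_zero[of 10] by (simp del: ln_ge_zero)
    then have "norm (Ln (u + 10)) \<le> 1 / 10 * norm u + 9"
      using norm_Ln_add_10_diff_le[of u 0] Re norm_triangle_ineq2[of "Ln (u + 10)" "Ln 10"] by simp
    then have "norm (\<phi> u) \<le> 20 * norm u"
      using norm_triangle_ineq4[of u "2 * Ln (u + 10)"] n1 by (simp add: \<phi>_def norm_mult)
    moreover have "\<phi> u = of_real (pi * of_int (2 * N u + 1)) * \<i>"
      using N[OF u] by (simp add: algebra_simps)
    then have "norm (\<phi> u) = pi * \<bar>of_int (2 * N u + 1)\<bar>"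
      by (simp only: norm_mult norm_of_real) (simp add: abs_mult)
    moreover have "1 * \<bar>real_of_int (2 * N u + 1)\<bar> \<le> pi * \<bar>of_int (2 * N u + 1)\<bar>"
      using pi_ge_two by (intro mult_right_mono) auto
    moreover have "real (int_encode (N u)) + 1 \<le> 2 * \<bar>real_of_int (2 * N u + 1)\<bar>"
      by (simp add: int_encode_def sum_encode_def)
    ultimately have "real (int_encode (N u)) + 1 \<le> 40 * norm u" by linarith
    then have "(real (int_encode (N u)) + 1)\<^sup>2 \<le> (40 * norm u)\<^sup>2" by (intro power_mono) auto
    then have "1600 / (40 * norm u)\<^sup>2 \<le> 1600 / (real (int_encode (N u)) + 1)\<^sup>2"
      using n1 by (intro divide_left_mono mult_pos_pos zero_less_power) auto
    then show ?thesis by (simp add: power_mult_distrib)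
  qed
  have "(\<lambda>n. 1600 / (real n + 1)\<^sup>2) summable_on UNIV"
    by (intro summable_nonneg_imp_summable_on summable_inverse_Suc_squares) auto
  then have "(\<lambda>n. 1600 / (real n + 1)\<^sup>2) summable_on (\<lambda>u. int_encode (N u)) ` expfac_zeros"
    by (rule summable_on_subset_banach) auto
  then have "(\<lambda>u. 1600 / (real (int_encode (N u)) + 1)\<^sup>2) summable_on expfac_zeros"
    by (simp add: summable_on_reindex[OF inj] o_def)
  then show ?thesis
    by (rule summable_on_comparison_test) (use bound in auto)
qed

text \<open>At height close to \<open>(2k+1)\<pi>\<close> on the imaginary axis both \<open>exp w\<close> and \<open>(w + 10)\<^sup>2\<close> point in
  direction \<open>-1\<close>, so \<open>expfac w\<close> is far from \<open>-1\<close>.\<close>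

lemma norm_one_plus_expfac_ge:
  "\<forall>\<^sub>F k in sequentially. \<forall>w. norm w = (2 * real k + 1) * pi \<longrightarrow> Re w > 0 \<longrightarrow> norm (1 + expfac w) \<ge> 1/2"
proof -
  define L where "L X = ln (2 * (X + 10)\<^sup>2)" for X :: real
  have X: "filterlim (\<lambda>k. (2 * real k + 1) * pi) at_top sequentially" by real_asymp
  have "\<forall>\<^sub>F X in at_top. (L X)\<^sup>2 / X \<le> 1/10" unfolding L_def by real_asymp
  moreover have "\<forall>\<^sub>F X in at_top. L X + 10 \<le> X / 4" unfolding L_def by real_asymp
  ultimately have "\<forall>\<^sub>F X in at_top. (L X)\<^sup>2 / X \<le> 1/10 \<and> L X + 10 \<le> X / 4 \<and> X \<ge> 1"
    using eventually_ge_at_top[of 1] by eventually_elim auto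
  from eventually_compose_filterlim[OF this X] show ?thesis
  proof (eventually_elim, intro allI impI)
    fix k w
    define X where "X = (2 * real k + 1) * pi"
    assume el: "(L ((2 * real k + 1) * pi))\<^sup>2 / ((2 * real k + 1) * pi) \<le> 1/10 \<and>
        L ((2 * real k + 1) * pi) + 10 \<le> (2 * real k + 1) * pi / 4 \<and> (2 * real k + 1) * pi \<ge> 1"
      and w: "norm w = (2 * real k + 1) * pi" "Re w > 0"
    have X: "(L X)\<^sup>2 / X \<le> 1/10" "L X + 10 \<le> X / 4" "X \<ge> 1" "norm w = X"
      using el w by (simp_all add: X_def)
    define p y where "p = Re w" and "y = Im w"
    show "norm (1 + expfac w) \<ge> 1/2"
    \<comment> \<open>A large \<open>expfac w\<close> is trivially far from -1. Otherwise
      \<open>exp (Re w)\<close> is at most quadratic in \<open>X\<close>, so \<open>Re w\<close> is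
      at most the logarithmic quantity \<open>L X\<close>, and \<open>w\<close> lies close to the
      imaginary axis.\<close>
    proof (cases "norm (expfac w) \<ge> 3/2")
      case True
      then show ?thesis using norm_triangle_ineq2[of "expfac w" "-1"] by (simp add: add.commute)
    next
      case False
      have "norm (w + 10) \<le> X + 10" using norm_triangle_ineq[of w 10] X by simp
      then have nX: "(norm (w + 10))\<^sup>2 \<le> (X + 10)\<^sup>2" by (intro power_mono) auto
      have n0: "norm (w + 10) > 0" using norm_add_10_ge(3)[of w] w by simp
      have "exp p / (norm (w + 10))\<^sup>2 < 3/2" using False by (simp add: norm_expfac p_def)
      with n0 have "exp p < 3/2 * (norm (w + 10))\<^sup>2" by (simp add: pos_divide_less_eq)
      also have "\<dots> \<le> 2 * (X + 10)\<^sup>2" using nX by (intro mult_mono) auto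
      finally have "exp p \<le> 2 * (X + 10)\<^sup>2" by simp
      then have "p \<le> L X" unfolding L_def
        by (metis exp_gt_zero ln_exp ln_le_cancel_iff order_less_le_trans)
      then have "p\<^sup>2 \<le> (L X)\<^sup>2" using w by (intro power_mono) (auto simp: p_def)
      then have "p\<^sup>2 / X \<le> 1/10" using X by (smt (verit) divide_right_mono)
      then have pX: "p\<^sup>2 \<le> X / 10" using X(3) by (simp add: field_simps)
      have "X\<^sup>2 = p\<^sup>2 + y\<^sup>2" unfolding X(4)[symmetric] p_def y_def by (rule cmod_power2)
      \<comment> \<open>This factorisation shows that \<open>X - \<bar>y\<bar>\<close> is at most
        \<open>p^2 / X\<close>: the height \<open>\<bar>y\<bar>\<close> is within 1/10 of the odd
        multiple \<open>X\<close> of pi.\<close>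
      then have "(X - \<bar>y\<bar>) * (X + \<bar>y\<bar>) = p\<^sup>2" by (simp add: algebra_simps power2_eq_square)
      moreover have yX: "\<bar>y\<bar> \<le> X" unfolding X(4)[symmetric] y_def by (rule abs_Im_le_cmod)
      then have "(X - \<bar>y\<bar>) * X \<le> (X - \<bar>y\<bar>) * (X + \<bar>y\<bar>)" using X by (intro mult_left_mono) auto
      ultimately have "(X - \<bar>y\<bar>) * X \<le> 1/10 * X" using pX by linarith
      then have d: "X - \<bar>y\<bar> \<le> 1/10" by (rule mult_right_le_imp_le) (use X in auto)
      define q where "q = p + 10"
      have q: "q > 0" "q \<le> \<bar>y\<bar> / 2" using \<open>p \<le> L X\<close> X d w by (auto simp: q_def p_def)
      have trig: "cos y = - cos (X - \<bar>y\<bar>)" "\<bar>sin y\<bar> = \<bar>sin (X - \<bar>y\<bar>)\<bar>"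
      proof -
        have odd: "cos X = - 1" "sin X = 0"
          using cos_npi[of "2 * k + 1"] sin_npi[of "2 * k + 1"] by (simp_all add: X_def algebra_simps)
        show "cos y = - cos (X - \<bar>y\<bar>)" using odd by (simp add: cos_diff abs_if)
        show "\<bar>sin y\<bar> = \<bar>sin (X - \<bar>y\<bar>)\<bar>" using odd by (simp add: sin_diff abs_if)
      qed
      have "cos (X - \<bar>y\<bar>) \<ge> 1/2"
        using cos_ge_minus_one d yX cos_monotone_0_pi_le[of "X - \<bar>y\<bar>" "pi/3"] pi_ge_two cos_60 by auto
      then have c: "cos y \<le> - 1/2" using trig by simp
      have "\<bar>sin (X - \<bar>y\<bar>)\<bar> \<le> \<bar>X - \<bar>y\<bar>\<bar>" by (rule abs_sin_x_le_abs_x)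
      then have s: "\<bar>sin y\<bar> \<le> 1/10" using trig d yX by simp
      define v where "v = (w + 10)\<^sup>2"
      have v: "Re v = q\<^sup>2 - y\<^sup>2" "Im v = 2 * q * y"
        by (simp_all add: v_def q_def p_def y_def power2_eq_square algebra_simps)
      have "q\<^sup>2 \<le> (\<bar>y\<bar> / 2)\<^sup>2" using q by (intro power_mono) auto
      then have q2: "q\<^sup>2 \<le> y\<^sup>2 / 4" by (simp add: power2_eq_square)
      \<comment> \<open>The sign of \<open>Re (exp w / v)\<close> is that of
        \<open>Re (exp w * cnj v)\<close>. Up to the factor \<open>exp p\<close>, the cosine term
        contributes at least 3/8 and the sine term at least -1/10 times the square of
        \<open>y\<close>.\<close>
      have "(- cos y) * (y\<^sup>2 - q\<^sup>2) \<ge> 1/2 * (3/4 * y\<^sup>2)"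
        using c q2 by (intro mult_mono) auto
      moreover have "\<bar>sin y * (2 * q * y)\<bar> \<le> 1/10 * y\<^sup>2"
      proof -
        have "\<bar>sin y * (2 * q * y)\<bar> = \<bar>sin y\<bar> * (2 * q * \<bar>y\<bar>)" using q by (simp add: abs_mult)
        also have "\<dots> \<le> 1/10 * (\<bar>y\<bar> * \<bar>y\<bar>)" using s q by (intro mult_mono) auto
        finally show ?thesis by (simp add: power2_eq_square)
      qed
      moreover have "cos y * (q\<^sup>2 - y\<^sup>2) = (- cos y) * (y\<^sup>2 - q\<^sup>2)" by (simp add: algebra_simps)
      moreover have "y\<^sup>2 \<ge> 0" by simp
      ultimately have "cos y * (q\<^sup>2 - y\<^sup>2) + sin y * (2 * q * y) \<ge> 0" by linarith
      then have "0 \<le> exp p * (cos y * (q\<^sup>2 - y\<^sup>2) + sin y * (2 * q * y))" by simp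
      also have "\<dots> = Re (exp w) * Re v + Im (exp w) * Im v"
        by (simp add: v Re_exp Im_exp p_def y_def algebra_simps)
      finally have "Re (exp w / v) \<ge> 0" by (simp add: Re_divide)
      then have "Re (1 + expfac w) \<ge> 1" by (simp add: expfac_def v_def)
      then show ?thesis using complex_Re_le_cmod[of "1 + expfac w"] by linarith
    qed
  qed
qed

section \<open>The power map and its Cauchy kernel\<close>

locale sector = fixes \<gamma> :: real assumes \<gamma>_pos: "0 < \<gamma>" and \<gamma>_less: "\<gamma> < 1"
begin

definition pw :: "complex \<Rightarrow> complex" where "pw w = w powr of_real \<gamma>"

definition pw' :: "complex \<Rightarrow> complex" where "pw' w = of_real \<gamma> * w powr (of_real \<gamma> - 1)"

lemma norm_pw: "norm (pw w) = norm w powr \<gamma>"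
  by (simp add: pw_def norm_powr_real_powr')

lemma pw_eq_exp: "w \<noteq> 0 \<Longrightarrow> pw w = exp (of_real \<gamma> * Ln w)"
  by (simp add: pw_def powr_def)

lemma Im_Ln_pw: "Re w > 0 \<Longrightarrow> \<bar>\<gamma> * Im (Ln w)\<bar> < pi / 2"
proof -
  assume "Re w > 0"
  then have "\<bar>Im (Ln w)\<bar> < pi / 2" using Re_Ln_pos_lt_imp[of w] by auto
  then have "\<gamma> * \<bar>Im (Ln w)\<bar> < pi / 2"
    by (smt (verit) \<gamma>_less \<gamma>_pos mult_left_le_one_le)
  then show ?thesis using \<gamma>_pos by (simp add: abs_mult)
qed

text \<open>Because \<open>\<gamma> < 1\<close>, the imaginary part of
  \<open>\<gamma> * Ln w\<close> stays in the principal range. This makes \<open>pw\<close>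
  injective on the right half-plane with inverse \<open>z powr (1 / \<gamma>)\<close>.\<close>

lemma Ln_pw: "Re w > 0 \<Longrightarrow> Ln (pw w) = of_real \<gamma> * Ln w"
  using Im_Ln_pw[of w] by (subst pw_eq_exp) (auto intro!: Ln_exp simp: abs_less_iff)

lemma Re_pw_pos: "Re w > 0 \<Longrightarrow> Re (pw w) > 0"
proof -
  assume w: "Re w > 0"
  have "cos (\<gamma> * Im (Ln w)) > 0"
    using Im_Ln_pw[OF w] by (intro cos_gt_zero_pi) linarith+
  moreover have "w \<noteq> 0" using w by auto
  ultimately show ?thesis by (simp add: pw_eq_exp Re_exp)
qed

lemma pw_powr_inverse: "Re w > 0 \<Longrightarrow> pw w powr (1 / of_real \<gamma>) = w"
proof -
  assume w: "Re w > 0"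
  then have "w \<noteq> 0" "pw w \<noteq> 0" using Re_pw_pos[OF w] by auto
  then show ?thesis using w \<gamma>_pos by (simp add: powr_def Ln_pw exp_Ln)
qed

lemma pw_eq_iff: "Re w > 0 \<Longrightarrow> Re u > 0 \<Longrightarrow> pw w = pw u \<longleftrightarrow> w = u"
  by (metis pw_powr_inverse)

lemma pw_has_field_derivative:
  "Re w > 0 \<Longrightarrow> (pw has_field_derivative pw' w) (at w)"
  unfolding pw_def[abs_def] pw'_def
  by (rule has_field_derivative_powr) (auto simp: complex_nonpos_Reals_iff)

lemma deriv_pw: "Re w > 0 \<Longrightarrow> deriv pw w = pw' w"
  using pw_has_field_derivative DERIV_imp_deriv by blast

lemma holomorphic_on_pw: "S \<subseteq> {w. Re w > 0} \<Longrightarrow> pw holomorphic_on S"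
  unfolding holomorphic_on_def field_differentiable_def
  using pw_has_field_derivative has_field_derivative_at_within by blast

lemma norm_pw': "norm (pw' w) = \<gamma> * norm w powr (\<gamma> - 1)"
  using \<gamma>_pos by (simp add: pw'_def norm_mult norm_powr_real_powr')

lemma pw'_nonzero: "w \<noteq> 0 \<Longrightarrow> pw' w \<noteq> 0"
  using \<gamma>_pos by (simp add: pw'_def)

lemma holomorphic_on_pw': "S \<subseteq> {w. Re w > 0} \<Longrightarrow> pw' holomorphic_on S"
  unfolding pw'_def[abs_def]
  by (intro holomorphic_intros) (auto simp: complex_nonpos_Reals_iff)

lemma norm_pw'_le: "1 \<le> norm w \<Longrightarrow> norm (pw' w) \<le> 1"
proof -
  assume "1 \<le> norm w"
  then have "norm w powr (\<gamma> - 1) \<le> norm w powr 0"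
    using \<gamma>_less by (intro powr_mono) auto
  moreover have "norm w \<noteq> 0" using \<open>1 \<le> norm w\<close> by force
  ultimately have "norm w powr (\<gamma> - 1) \<le> 1" by simp
  then have "\<gamma> * norm w powr (\<gamma> - 1) \<le> 1 * 1"
    using \<gamma>_pos \<gamma>_less by (intro mult_mono) auto
  then show ?thesis by (simp add: norm_pw')
qed

text \<open>The image of a disc of radius \<open>1/2\<close> contains a disc of comparable radius \<open>norm (pw' w)\<close> (Bloch),
  so the Cauchy kernel in the coordinate \<open>w\<close> is bounded as soon as \<open>z\<close> is not in that image.\<close>

lemma kernel_bound:
  assumes w: "Re w \<ge> 1" and z: "z \<notin> pw ` ball w (1/2)"
  shows "norm (pw' w / (pw w - z)) \<le> 12"
proof -
  have re: "Re u \<ge> Re w - 1/2" if "u \<in> cball w (1/2)" for u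
    using that abs_Re_le_cmod[of "w - u"] by (auto simp: dist_norm)
  have pos: "cball w (1/2) \<subseteq> {w. Re w > 0}" using re w by force
  have w0: "w \<noteq> 0" "norm w \<ge> 1" using w complex_Re_le_cmod[of w] by auto
  have "ball (pw w) ((3 - 2 * sqrt 2) * (1/2) * norm (deriv pw w)) \<subseteq> pw ` ball w (1/2)"
  proof (rule Bloch_lemma)
    show "pw holomorphic_on cball w (1/2)" using pos by (rule holomorphic_on_pw)
    fix u assume u: "u \<in> ball w (1/2)"
    then have "Re u > 0" using pos by force
    have "norm w \<le> norm u + 1/2" using u norm_triangle_ineq[of u "w - u"] by (auto simp: dist_norm)
    then have "norm w / 2 \<le> norm u" using w0 by linarith
    moreover have "norm w / 2 > 0" using w0 by auto
    \<comment> \<open>On the disc the modulus can drop by at most a factor 2, so the derivative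
      grows by at most \<open>2 powr (1 - \<gamma>)\<close>. This is below the factor 2 that
      \<open>Bloch_lemma\<close> allows.\<close>
    ultimately have "norm u powr (\<gamma> - 1) \<le> (norm w / 2) powr (\<gamma> - 1)"
      using \<gamma>_less by (intro powr_mono2') auto
    also have "\<dots> = norm w powr (\<gamma> - 1) * 2 powr (1 - \<gamma>)"
      by (simp add: powr_divide powr_minus_divide powr_diff)
    also have "\<dots> \<le> norm w powr (\<gamma> - 1) * 2 powr 1"
      using \<gamma>_pos by (intro mult_left_mono powr_mono) auto
    finally have "\<gamma> * norm u powr (\<gamma> - 1) \<le> 2 * (\<gamma> * norm w powr (\<gamma> - 1))"
      using \<gamma>_pos by (simp add: mult_left_mono)
    then show "norm (deriv pw u) \<le> 2 * norm (deriv pw w)"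
      using \<open>Re u > 0\<close> w by (simp add: deriv_pw norm_pw')
  qed auto
  then have "z \<notin> ball (pw w) ((3 - 2 * sqrt 2) * (1/2) * norm (pw' w))"
    using z w by (auto simp: deriv_pw)
  then have 1: "(3 - 2 * sqrt 2) * (1/2) * norm (pw' w) \<le> norm (pw w - z)"
    by (simp add: dist_norm)
  \<comment> \<open>The estimate of sqrt 2 by 17/12 turns the Bloch radius factor
    \<open>(3 - 2 * sqrt 2) / 2\<close> into 1/12, the source of the constant 12.\<close>
  have "sqrt 2 \<le> sqrt ((17/12)\<^sup>2)" by (intro real_sqrt_le_mono) (simp add: power2_eq_square)
  then have "1/12 \<le> (3 - 2 * sqrt 2) * (1/2)" by simp
  then have "1/12 * norm (pw' w) \<le> (3 - 2 * sqrt 2) * (1/2) * norm (pw' w)"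
    by (rule mult_right_mono) simp
  with 1 have "norm (pw' w) \<le> 12 * norm (pw w - z)" by linarith
  moreover from this have "norm (pw w - z) > 0"
    using pw'_nonzero[OF w0(1)] by (smt (verit) zero_less_norm_iff)
  ultimately have "norm (pw' w) / norm (pw w - z) \<le> 12" by (simp add: field_simps)
  then show ?thesis by (simp add: norm_divide)
qed

text \<open>The map is proper, since \<open>norm (pw w) = norm w powr \<gamma>\<close>: the part of
  the image in a closed disc is the image of a compact set. A convergent sequence is bounded and so
  lies in one such disc.\<close>

lemma closed_pw_image:
  assumes S: "closed S" "S \<subseteq> {w. Re w > 0}"
  shows "closed (pw ` S)"
proof -
  have *: "closed (pw ` S \<inter> cball 0 R)" if "R > 0" for R
  proof -
    have *: "norm (pw w) \<le> R \<longleftrightarrow> norm w \<le> R powr (1 / \<gamma>)" for w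
    proof -
      have "norm (pw w) \<le> R \<longleftrightarrow> norm w powr \<gamma> \<le> (R powr (1/\<gamma>)) powr \<gamma>"
        using that \<gamma>_pos by (simp add: norm_pw powr_powr)
      also have "\<dots> \<longleftrightarrow> norm w \<le> R powr (1/\<gamma>)"
        using powr_less_mono2[OF \<gamma>_pos, of "R powr (1/\<gamma>)" "norm w"]
          powr_mono2[of \<gamma> "norm w" "R powr (1/\<gamma>)"] \<gamma>_pos by force
      finally show ?thesis .
    qed
    have "pw ` S \<inter> cball 0 R = pw ` (S \<inter> cball 0 (R powr (1/\<gamma>)))"
      using * by auto
    moreover have "compact (S \<inter> cball 0 (R powr (1/\<gamma>)))"
      using S by (simp add: closed_Int_compact)
    moreover have "continuous_on (S \<inter> cball 0 (R powr (1/\<gamma>))) pw"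
      using S by (intro holomorphic_on_imp_continuous_on holomorphic_on_pw) auto
    ultimately show ?thesis by (simp add: compact_continuous_image compact_imp_closed)
  qed
  show ?thesis
    unfolding closed_sequential_limits
  proof (intro allI impI)
    fix x l assume x: "(\<forall>n. x n \<in> pw ` S) \<and> x \<longlonglongrightarrow> l"
    then have "Bseq x" by (meson convergentI convergent_imp_Bseq)
    then obtain R where R: "R > 0" "\<And>n. norm (x n) \<le> R" by (auto simp: Bseq_def)
    have mem: "x n \<in> pw ` S \<inter> cball 0 R" for n using x R by auto
    from closed_sequentially[where f = x, OF *[OF R(1)] mem] x show "l \<in> pw ` S" by blast
  qed
qed

lemma open_pw_image:
  assumes S: "open S" "S \<subseteq> {w. Re w > 0}"
  shows "open (pw ` S)"
  by (rule open_mapping_thm3[OF holomorphic_on_pw[OF S(2)] S(1)])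
    (use S pw_eq_iff in \<open>auto simp: inj_on_def subset_iff\<close>)

end

section \<open>The Cauchy integral and its jump\<close>

lemma in_segment_Complex_iff:
  "y1 \<le> y2 \<Longrightarrow> w \<in> closed_segment (Complex x y1) (Complex x y2) \<longleftrightarrow> Re w = x \<and> Im w \<in> {y1..y2}"
  "x1 \<le> x2 \<Longrightarrow> w \<in> closed_segment (Complex x1 y) (Complex x2 y) \<longleftrightarrow> Im w = y \<and> Re w \<in> {x1..x2}"
  by (auto simp: closed_segment_same_Re closed_segment_same_Im closed_segment_eq_real_ivl)

context sector begin

text \<open>The Cauchy kernel with density \<open>logfac\<close>, pulled back by the substitution
  \<open>s = pw w\<close>. All integrations then run along straight segments in the
  \<open>w\<close>-plane.\<close>

definition kern :: "complex \<Rightarrow> complex \<Rightarrow> complex"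
  where "kern z w = logfac w * pw' w / (pw w - z)"

text \<open>A unit segment of the line \<open>Re w = c\<close> together with its mirror image, both
  oriented upwards. The improper integral over the line becomes an absolutely convergent series
  whose partial sums are integrals over symmetric segments.\<close>

definition cauchy_term :: "real \<Rightarrow> nat \<Rightarrow> complex \<Rightarrow> complex" where
  "cauchy_term c n z =
     contour_integral (linepath (Complex c (real n)) (Complex c (real n + 1))) (kern z) +
     contour_integral (linepath (Complex c (- real n - 1)) (Complex c (- real n))) (kern z)"

definition cauchy_int :: "real \<Rightarrow> complex \<Rightarrow> complex" where
  "cauchy_int c z = (\<Sum>n. cauchy_term c n z) / (2 * pi * \<i>)"

lemma continuous_on_kern_nums:
  assumes "S \<subseteq> {w. 0 < Re w \<and> Re w \<le> 3}"
  shows "continuous_on S (\<lambda>w. logfac w * pw' w)" "continuous_on S pw"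
proof -
  have "(\<lambda>w. logfac w * pw' w) holomorphic_on S"
    using assms by (intro holomorphic_on_mult holomorphic_on_subset[OF holomorphic_on_logfac]
        holomorphic_on_pw') auto
  then show "continuous_on S (\<lambda>w. logfac w * pw' w)" by (rule holomorphic_on_imp_continuous_on)
  show "continuous_on S pw"
    using assms by (intro holomorphic_on_imp_continuous_on holomorphic_on_pw) auto
qed

lemma continuous_on_kern:
  assumes "S \<subseteq> {w. 0 < Re w \<and> Re w \<le> 3}" "z \<notin> pw ` S"
  shows "continuous_on S (kern z)"
  unfolding kern_def[abs_def]
  using assms by (intro continuous_on_divide continuous_on_kern_nums continuous_on_diff continuous_on_const) auto

lemma norm_kern_le:
  assumes "1 \<le> Re w" "Re w \<le> 3" "real n \<le> \<bar>Im w\<bar>" "norm (pw' w / (pw w - z)) \<le> B"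
  shows "norm (kern z w) \<le> 216 / (real n + 1)\<^sup>2 * B"
proof -
  have "norm (kern z w) = norm (logfac w) * norm (pw' w / (pw w - z))"
    by (simp add: kern_def norm_mult norm_divide)
  also have "\<dots> \<le> 216 / (real n + 1)\<^sup>2 * B"
    using assms by (intro mult_mono norm_logfac_Im_le) auto
  finally show ?thesis .
qed

lemma norm_cauchy_term_le:
  assumes c: "1 \<le> c" "c \<le> 3" and z: "z \<notin> pw ` {w. Re w = c}"
    and B: "\<And>w. Re w = c \<Longrightarrow> norm (pw' w / (pw w - z)) \<le> B"
  shows "norm (cauchy_term c n z) \<le> 432 * B / (real n + 1)\<^sup>2"
proof -
  have B0: "0 \<le> B" using B[of "of_real c"] norm_ge_zero order_trans by (metis Re_complex_of_real)
  have *: "norm (contour_integral (linepath (Complex c y) (Complex c y')) (kern z)) \<le> 216 / (real n + 1)\<^sup>2 * B"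
    if y: "y' = y + 1" "\<And>t. t \<in> {y..y'} \<Longrightarrow> real n \<le> \<bar>t\<bar>" for y y'
  proof -
    have "norm (contour_integral (linepath (Complex c y) (Complex c y')) (kern z))
       \<le> 216 / (real n + 1)\<^sup>2 * B * norm (Complex c y' - Complex c y)"
    proof (rule contour_integral_bound_linepath)
      show "kern z contour_integrable_on linepath (Complex c y) (Complex c y')"
        using c z y(1) by (intro contour_integrable_continuous_linepath continuous_on_kern)
          (auto simp: in_segment_Complex_iff)
    next
      fix w assume "w \<in> closed_segment (Complex c y) (Complex c y')"
      then have "Re w = c" "Im w \<in> {y..y'}" using y(1) by (auto simp: in_segment_Complex_iff)
      then show "norm (kern z w) \<le> 216 / (real n + 1)\<^sup>2 * B"
        using c B y by (intro norm_kern_le) auto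
    qed (use B0 in auto)
    moreover have "Complex c y' - Complex c y = \<i>" using y(1) by (simp add: complex_eq_iff)
    ultimately show ?thesis by simp
  qed
  show ?thesis
    unfolding cauchy_term_def
    using norm_triangle_le[OF add_mono[OF *[of "real n + 1" "real n"] *[of "- real n" "- real n - 1"]]]
    by auto
qed

lemma sums_cauchy_int:
  assumes c: "1 \<le> c" "c \<le> 3" and z: "z \<notin> pw ` {w. Re w = c}"
    and B: "\<And>w. Re w = c \<Longrightarrow> norm (pw' w / (pw w - z)) \<le> B"
  shows "(\<lambda>n. cauchy_term c n z) sums (2 * pi * \<i> * cauchy_int c z)"
proof -
  have "summable (\<lambda>n. cauchy_term c n z)"
    by (rule summable_comparison_test'[OF summable_inverse_Suc_squares])
      (use norm_cauchy_term_le[OF assms] in auto)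
  then show ?thesis by (simp add: cauchy_int_def summable_sums)
qed

lemma norm_cauchy_int_le:
  assumes c: "1 \<le> c" "c \<le> 3" and z: "z \<notin> pw ` {w. Re w = c}"
    and B: "\<And>w. Re w = c \<Longrightarrow> norm (pw' w / (pw w - z)) \<le> B"
  shows "norm (cauchy_int c z) \<le> (\<Sum>n. 432 * B / (real n + 1)\<^sup>2)"
proof -
  have "norm (\<Sum>n. cauchy_term c n z) \<le> (\<Sum>n. 432 * B / (real n + 1)\<^sup>2)"
    by (rule norm_suminf_le[OF norm_cauchy_term_le[OF assms] summable_inverse_Suc_squares])
  moreover have "norm (cauchy_int c z) \<le> norm (\<Sum>n. cauchy_term c n z)"
  proof -
    have "norm (cauchy_int c z) = norm (\<Sum>n. cauchy_term c n z) / (2 * pi)"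
      by (simp add: cauchy_int_def norm_divide norm_mult)
    also have "\<dots> \<le> norm (\<Sum>n. cauchy_term c n z) / 1"
      using pi_ge_two by (intro divide_left_mono) auto
    finally show ?thesis by simp
  qed
  ultimately show ?thesis by linarith
qed

section \<open>Holomorphy of the Cauchy integral off the curve\<close>

lemma closed_pw_line: "0 < c \<Longrightarrow> closed (pw ` {w. Re w = c})"
  by (rule closed_pw_image) (auto simp: closed_halfspace_Re_eq)

text \<open>A crude bound that degenerates near the curve but is locally uniform in
  \<open>z\<close>, which is enough for convergence and holomorphy. The uniform constant of
  \<open>kernel_bound\<close> serves for the global size estimates.\<close>

lemma kernel_bound_ball:
  assumes "1 \<le> c" "0 < d" "cball z d \<inter> pw ` {w. Re w = c} = {}" "Re w = c" 
  shows "norm (pw' w / (pw w - z)) \<le> 1 / d"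
proof -
  have "norm (pw' w) \<le> 1" using assms complex_Re_le_cmod[of w] by (intro norm_pw'_le) auto
  moreover have "pw w \<notin> cball z d" using assms by blast
  then have "d < dist z (pw w)" by simp
  ultimately have "norm (pw' w) / norm (pw w - z) \<le> 1 / d"
    using assms by (intro frac_le) (auto simp: dist_norm norm_minus_commute)
  then show ?thesis by (simp add: norm_divide)
qed

lemma kernel_bounded_off_line:
  assumes "1 \<le> c" "z \<notin> pw ` {w. Re w = c}"
  obtains B where "\<And>w. Re w = c \<Longrightarrow> norm (pw' w / (pw w - z)) \<le> B"
proof -
  have "open (- pw ` {w. Re w = c})" using closed_pw_line[of c] assms by auto
  then obtain d where "d > 0" "cball z d \<subseteq> - pw ` {w. Re w = c}"
    using assms by (metis ComplI open_contains_cball)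
  then have "cball z d \<inter> pw ` {w. Re w = c} = {}" by blast
  with assms(1) \<open>d > 0\<close> show ?thesis by (intro that[of "1 / d"] kernel_bound_ball)
qed

lemma holomorphic_cauchy_int:
  assumes c: "1 \<le> c" "c \<le> 3"
  shows "cauchy_int c holomorphic_on - pw ` {w. Re w = c}"
proof -
  let ?U = "- pw ` {w. Re w = c}"
  have U: "open ?U" using closed_pw_line[of c] c by auto
  have 1: "cauchy_term c n holomorphic_on ?U" for n
  proof -
    have "(\<lambda>z. contour_integral (linepath (Complex c y) (Complex c (y + 1))) (kern z)) holomorphic_on ?U" for y
      unfolding kern_def[abs_def]
      using c by (intro contour_integral_linepath_cauchy_kernel_holomorphic U continuous_on_kern_nums)
        (auto simp: in_segment_Complex_iff)
    from holomorphic_on_add[OF this[of "real n"] this[of "- real n - 1"]] show ?thesis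
      by (simp add: cauchy_term_def[abs_def])
  qed
  have "(\<lambda>z. \<Sum>n. cauchy_term c n z) holomorphic_on ?U"
  proof (rule holomorphic_uniform_sequence[OF U, where f = "\<lambda>N z. \<Sum>n<N. cauchy_term c n z"])
    show "(\<lambda>z. \<Sum>n<N. cauchy_term c n z) holomorphic_on ?U" for N
      using 1 by (intro holomorphic_intros) 
    fix z assume "z \<in> ?U"
    then obtain d where d: "d > 0" "cball z d \<subseteq> ?U"
      using U by (metis open_contains_cball)
    \<comment> \<open>Halving the radius leaves a margin \<open>d/2\<close> around every point of
      the smaller disc, so a single majorant serves the M-test on all of it.\<close>
    have d2: "cball x (d/2) \<inter> pw ` {w. Re w = c} = {}" if "x \<in> cball z (d/2)" for x
    proof -
      have "cball x (d/2) \<subseteq> cball z d"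
      proof
        fix y assume "y \<in> cball x (d/2)"
        then show "y \<in> cball z d" using that dist_triangle[of z y x] by simp
      qed
      then show ?thesis using d(2) by auto
    qed
    have "uniform_limit (cball z (d/2)) (\<lambda>N z. \<Sum>n<N. cauchy_term c n z) (\<lambda>z. \<Sum>n. cauchy_term c n z) sequentially"
    proof (rule Weierstrass_m_test)
      fix n x assume x: "x \<in> cball z (d/2)"
      have "x \<in> cball x (d/2)" using d(1) by simp
      with d2[OF x] have "x \<notin> pw ` {w. Re w = c}" by blast
      then show "norm (cauchy_term c n x) \<le> 432 * (1 / (d/2)) / (real n + 1)\<^sup>2"
        using c d d2[OF x] by (intro norm_cauchy_term_le kernel_bound_ball) auto
    qed (rule summable_inverse_Suc_squares)
    moreover have "cball z (d/2) \<subseteq> cball z d" using d(1) by auto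
    ultimately show "\<exists>d>0. cball z d \<subseteq> ?U \<and> uniform_limit (cball z d) (\<lambda>N z. \<Sum>n<N. cauchy_term c n z)
       (\<lambda>z. \<Sum>n. cauchy_term c n z) sequentially"
      using d by (intro exI[of _ "d/2"]) auto
  qed
  then show ?thesis unfolding cauchy_int_def[abs_def] by (intro holomorphic_intros) auto
qed

section \<open>The jump relation, by residues on growing rectangles\<close>

lemma sum_cauchy_term:
  assumes c: "1 \<le> c" "c \<le> 3" and z: "z \<notin> pw ` {w. Re w = c}"
  shows "(\<Sum>n<N. cauchy_term c n z)
       = contour_integral (linepath (Complex c (- real N)) (Complex c (real N))) (kern z)"
proof (induction N)
  case 0
  show ?case using contour_integral_trivial[of "Complex c 0" "kern z"]
    by (simp only: of_nat_0 minus_zero lessThan_0 sum.empty)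
next
  case (Suc N)
  have cont: "continuous_on (closed_segment (Complex c y) (Complex c y')) (kern z)" if "y \<le> y'" for y y'
    using that c z by (intro continuous_on_kern) (auto simp: in_segment_Complex_iff)
  have "contour_integral (linepath (Complex c (- real N - 1)) (Complex c (real N + 1))) (kern z)
     = contour_integral (linepath (Complex c (- real N - 1)) (Complex c (- real N))) (kern z)
     + contour_integral (linepath (Complex c (- real N)) (Complex c (real N + 1))) (kern z)"
    by (intro contour_integral_split_linepath cont) (auto simp: in_segment_Complex_iff)
  also have "contour_integral (linepath (Complex c (- real N)) (Complex c (real N + 1))) (kern z)
     = contour_integral (linepath (Complex c (- real N)) (Complex c (real N))) (kern z)
     + contour_integral (linepath (Complex c (real N)) (Complex c (real N + 1))) (kern z)"
    by (intro contour_integral_split_linepath cont) (auto simp: in_segment_Complex_iff)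
  finally have 1: "contour_integral (linepath (Complex c (- real N - 1)) (Complex c (real N + 1))) (kern z)
     = contour_integral (linepath (Complex c (- real N)) (Complex c (real N))) (kern z) + cauchy_term c N z"
    by (simp add: cauchy_term_def)
  have e: "real (Suc N) = real N + 1" "- (real N + 1) = - real N - 1" by auto
  show ?case unfolding e sum.lessThan_Suc Suc.IH 1 ..
qed

lemma cauchy_int_limit:
  assumes c: "1 \<le> c" "c \<le> 3" and z: "z \<notin> pw ` {w. Re w = c}"
  shows "(\<lambda>N. contour_integral (linepath (Complex c (- real N)) (Complex c (real N))) (kern z))
      \<longlonglongrightarrow> 2 * pi * \<i> * cauchy_int c z"
proof -
  obtain B where "\<And>w. Re w = c \<Longrightarrow> norm (pw' w / (pw w - z)) \<le> B"
    using kernel_bounded_off_line[OF c(1) z] by blast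
  from sums_cauchy_int[OF c z this] show ?thesis
    by (simp add: sums_def sum_cauchy_term[OF c z])
qed

text \<open>\<open>expfac\<close> has no zeros, so \<open>exp (logfac w)\<close> is never 1. This
  supplies the nonvanishing numerator that \<open>residue_simple_pole_deriv\<close> asks
  for.\<close>

lemma logfac_nonzero: "0 \<le> Re w \<Longrightarrow> Re w \<le> 3 \<Longrightarrow> logfac w \<noteq> 0"
  using exp_logfac[of w] norm_add_10_ge(3)[of w] by (auto simp: expfac_def)

text \<open>The factor \<open>pw'\<close> in the numerator cancels the derivative of the
  denominator, leaving the density itself.\<close>

lemma residue_kern:
  assumes "0 < Re u" "Re u < 3"
  shows "residue (kern (pw u)) u = logfac u"
proof -
  let ?S = "{w. 0 < Re w} \<inter> {w. Re w < 3}"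
  have "residue (\<lambda>w. logfac w * pw' w / (pw w - pw u)) u = logfac u * pw' u / pw' u"
  proof (rule residue_simple_pole_deriv)
    show "(\<lambda>w. logfac w * pw' w) holomorphic_on ?S"
      by (intro holomorphic_on_mult holomorphic_on_subset[OF holomorphic_on_logfac] holomorphic_on_pw') auto
    show "(\<lambda>w. pw w - pw u) holomorphic_on ?S"
      by (intro holomorphic_intros holomorphic_on_pw) auto
    show "open ?S" by (intro open_Int open_halfspace_Re_gt open_halfspace_Re_lt)
    show "connected ?S"
      by (intro convex_connected convex_Int convex_halfspace_Re_gt convex_halfspace_Re_lt)
    show "((\<lambda>w. pw w - pw u) has_field_derivative pw' u) (at u)"
      using pw_has_field_derivative[of u] assms by (auto intro!: derivative_eq_intros)
    have "u \<noteq> 0" using assms by auto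
    then have "pw' u \<noteq> 0" by (rule pw'_nonzero)
    then show "pw' u \<noteq> 0" "logfac u * pw' u \<noteq> 0"
      using logfac_nonzero[of u] assms by auto
  qed (use assms in auto)
  moreover have "u \<noteq> 0" using assms by auto
  then have "pw' u \<noteq> 0" by (rule pw'_nonzero)
  ultimately show ?thesis by (simp add: kern_def[abs_def])
qed

text \<open>The residue theorem on a rectangle between the lines \<open>Re w = 1\<close> and
  \<open>Re w = 2\<close>. Injectivity of \<open>pw\<close> makes \<open>u\<close> the only pole.
  All sides are written in the upward or rightward direction, which explains the two minus
  signs.\<close>

lemma contour_integral_rect_kern:
  assumes u: "1 < Re u" "Re u < 2" "\<bar>Im u\<bar> < y"
  shows "contour_integral (linepath (Complex 1 (-y)) (Complex 2 (-y))) (kern (pw u))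
       + contour_integral (linepath (Complex 2 (-y)) (Complex 2 y)) (kern (pw u))
       - contour_integral (linepath (Complex 1 y) (Complex 2 y)) (kern (pw u))
       - contour_integral (linepath (Complex 1 (-y)) (Complex 1 y)) (kern (pw u))
       = 2 * pi * \<i> * logfac u"
proof -
  let ?S = "{w. 0 < Re w} \<inter> {w. Re w < 3}" and ?f = "kern (pw u)"
  let ?R = "rectpath (Complex 1 (-y)) (Complex 2 y)"
  have y: "y > 0" using u by linarith
  have "contour_integral ?R ?f = 2 * pi * \<i> * (\<Sum>p\<in>{u}. winding_number ?R p * residue ?f p)"
  proof (rule Residue_theorem)
    show "open ?S" by (intro open_Int open_halfspace_Re_gt open_halfspace_Re_lt)
    show "connected ?S"
      by (intro convex_connected convex_Int convex_halfspace_Re_gt convex_halfspace_Re_lt)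
    show "?f holomorphic_on ?S - {u}" unfolding kern_def[abs_def] using u pw_eq_iff[of _ u]
      by (intro holomorphic_intros holomorphic_on_subset[OF holomorphic_on_logfac] holomorphic_on_pw' holomorphic_on_pw)
         auto
    show "path_image ?R \<subseteq> ?S - {u}" using u y by (subst path_image_rectpath) auto
    show "\<forall>z. z \<notin> ?S \<longrightarrow> winding_number ?R z = 0"
      using y by (auto intro!: winding_number_rectpath_outside simp: in_cbox_complex_iff)
  qed auto
  moreover have "winding_number ?R u = 1"
    using u by (intro winding_number_rectpath) (auto simp: in_box_complex_iff)
  moreover have "residue ?f u = logfac u" using u by (intro residue_kern) auto
  ultimately have 1: "contour_integral ?R ?f = 2 * pi * \<i> * logfac u" by simp
  have cont: "continuous_on (closed_segment a b) ?f"
    if "closed_segment a b \<subseteq> {w. 0 < Re w \<and> Re w \<le> 3} - {u}" for a b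
    using that pw_eq_iff[of u] u by (intro continuous_on_kern) (auto simp: subset_iff)
  have segs: "continuous_on (closed_segment (Complex 1 (-y)) (Complex 2 (-y))) ?f"
     "continuous_on (closed_segment (Complex 2 (-y)) (Complex 2 y)) ?f"
     "continuous_on (closed_segment (Complex 1 y) (Complex 2 y)) ?f"
     "continuous_on (closed_segment (Complex 1 (-y)) (Complex 1 y)) ?f"
    using u y by (intro cont; auto simp: in_segment_Complex_iff)+
  have rev: "?f contour_integrable_on linepath (Complex 2 y) (Complex 1 y)"
      "?f contour_integrable_on linepath (Complex 1 y) (Complex 1 (-y))"
    using segs by (metis closed_segment_commute contour_integrable_continuous_linepath)+
  have "contour_integral ?R ?f =
         contour_integral (linepath (Complex 1 (-y)) (Complex 2 (-y))) ?f
       + contour_integral (linepath (Complex 2 (-y)) (Complex 2 y)) ?f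
       + contour_integral (linepath (Complex 2 y) (Complex 1 y)) ?f
       + contour_integral (linepath (Complex 1 y) (Complex 1 (-y))) ?f"
    using segs(1,2)[THEN contour_integrable_continuous_linepath] rev
    by (simp add: rectpath_def Let_def contour_integrable_joinI)
  also have "contour_integral (linepath (Complex 2 y) (Complex 1 y)) ?f
           = - contour_integral (linepath (Complex 1 y) (Complex 2 y)) ?f"
    using segs by (intro contour_integral_reverse_linepath) (simp add: closed_segment_commute)
  also have "contour_integral (linepath (Complex 1 y) (Complex 1 (-y))) ?f
           = - contour_integral (linepath (Complex 1 (-y)) (Complex 1 y)) ?f"
    using segs by (intro contour_integral_reverse_linepath) (simp add: closed_segment_commute)
  finally show ?thesis using 1 by simp
qed

text \<open>At height \<open>N\<close> the density is \<open>O(1 / N^2)\<close>, and the kernel is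
  at most 1 once \<open>N powr \<gamma>\<close> exceeds \<open>norm z + 1\<close>. The function
  \<open>s\<close> covers the top and the bottom side at once.\<close>

lemma horizontal_kern_tendsto_0:
  assumes s: "\<And>N. \<bar>s N\<bar> = real N"
  shows "(\<lambda>N. contour_integral (linepath (Complex 1 (s N)) (Complex 2 (s N))) (kern z)) \<longlonglongrightarrow> 0"
proof -
  have lim: "filterlim (\<lambda>N. real N powr \<gamma>) at_top sequentially"
    by (intro filterlim_compose[OF real_powr_at_top[OF \<gamma>_pos]] filterlim_real_sequentially)
  then have "\<forall>\<^sub>F N in sequentially. real N powr \<gamma> \<ge> norm z + 1"
    by (simp add: filterlim_at_top)
  then have ev: "\<forall>\<^sub>F N in sequentially.
     norm (contour_integral (linepath (Complex 1 (s N)) (Complex 2 (s N))) (kern z)) \<le> 216 / (real N + 1)\<^sup>2"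
  proof eventually_elim
    case (elim N)
    have seg: "1 \<le> Re w \<and> Re w \<le> 2 \<and> \<bar>Im w\<bar> = real N"
      if "w \<in> closed_segment (Complex 1 (s N)) (Complex 2 (s N))" for w
      using that s by (auto simp: in_segment_Complex_iff)
    have far: "1 \<le> norm (pw w - z)" if "1 \<le> Re w \<and> Re w \<le> 2 \<and> \<bar>Im w\<bar> = real N" for w
    proof -
      have "real N powr \<gamma> \<le> norm (pw w)"
        unfolding norm_pw using that abs_Im_le_cmod[of w] \<gamma>_pos by (intro powr_mono2) auto
      then show ?thesis using elim norm_triangle_ineq2[of "pw w" z] by linarith
    qed
    have "norm (contour_integral (linepath (Complex 1 (s N)) (Complex 2 (s N))) (kern z))
       \<le> 216 / (real N + 1)\<^sup>2 * 1 * norm (Complex 2 (s N) - Complex 1 (s N))"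
    proof (rule contour_integral_bound_linepath)
      show "kern z contour_integrable_on linepath (Complex 1 (s N)) (Complex 2 (s N))"
        using seg far by (intro contour_integrable_continuous_linepath continuous_on_kern) force+
      fix w assume "w \<in> closed_segment (Complex 1 (s N)) (Complex 2 (s N))"
      note w = seg[OF this]
      have "norm (pw' w) \<le> 1" using w complex_Re_le_cmod[of w] by (intro norm_pw'_le) auto
      with far[OF w] have "norm (pw' w / (pw w - z)) \<le> 1"
        unfolding norm_divide by (subst divide_le_eq_1_pos) linarith+
      then show "norm (kern z w) \<le> 216 / (real N + 1)\<^sup>2 * 1" using w by (intro norm_kern_le) auto
    qed auto
    moreover have "Complex 2 (s N) - Complex 1 (s N) = 1" by (simp add: complex_eq_iff)
    ultimately show ?case by simp
  qed
  show ?thesis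
    by (rule Lim_null_comparison[OF ev summable_LIMSEQ_zero[OF summable_inverse_Suc_squares]])
qed

text \<open>As the height of the rectangle tends to infinity, its horizontal sides disappear and its
  vertical sides become the two Cauchy integrals, so their difference is the residue at
  \<open>u\<close>.\<close>

lemma cauchy_int_jump:
  assumes u: "1 < Re u" "Re u < 2"
  shows "cauchy_int 2 (pw u) - cauchy_int 1 (pw u) = logfac u"
proof -
  have off: "pw u \<notin> pw ` {w. Re w = c}" if "c \<in> {1, 2}" for c
  proof
    assume "pw u \<in> pw ` {w. Re w = c}"
    then obtain w where "Re w = c" "pw u = pw w" by auto
    with that u pw_eq_iff[of u w] show False by auto
  qed
  let ?L = "\<lambda>c N. contour_integral (linepath (Complex c (- real N)) (Complex c (real N))) (kern (pw u))"
  let ?H = "\<lambda>s N. contour_integral (linepath (Complex 1 (s N)) (Complex 2 (s N))) (kern (pw u))"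
  have lim: "(\<lambda>N. ?H (\<lambda>N. - real N) N + ?L 2 N - ?H real N - ?L 1 N)
      \<longlonglongrightarrow> 0 + 2 * pi * \<i> * cauchy_int 2 (pw u) - 0 - 2 * pi * \<i> * cauchy_int 1 (pw u)"
    by (intro tendsto_intros horizontal_kern_tendsto_0 cauchy_int_limit off) auto
  have ev: "\<forall>\<^sub>F N in sequentially. ?H (\<lambda>N. - real N) N + ?L 2 N - ?H real N - ?L 1 N = 2 * pi * \<i> * logfac u"
    using eventually_gt_at_top[of "nat \<lceil>\<bar>Im u\<bar>\<rceil>"]
    by eventually_elim (intro contour_integral_rect_kern u, linarith)
  note LIMSEQ_unique[OF lim tendsto_eventually[OF ev]]
  then have "2 * pi * \<i> * (cauchy_int 2 (pw u) - cauchy_int 1 (pw u)) = 2 * pi * \<i> * logfac u"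
    by (simp only: algebra_simps add_0_left)
  then show ?thesis by (subst (asm) mult_left_cancel) auto
qed

end

section \<open>Gluing to an entire function\<close>

lemma expfac_has_field_derivative:
  assumes "Re w \<ge> 0"
  shows "(expfac has_field_derivative expfac w * (1 - 2 / (w + 10))) (at w)"
proof -
  have "((\<lambda>w. exp w / (w + 10)\<^sup>2) has_field_derivative
      (exp w * (w + 10)\<^sup>2 - exp w * (2 * (w + 10))) / ((w + 10)\<^sup>2 * (w + 10)\<^sup>2)) (at w)"
    using norm_add_10_ge(3)[OF assms] by (auto intro!: derivative_eq_intros simp: power2_eq_square)
  also have "(exp w * (w + 10)\<^sup>2 - exp w * (2 * (w + 10))) / ((w + 10)\<^sup>2 * (w + 10)\<^sup>2)
      = expfac w * (1 - 2 / (w + 10))"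
  proof -
    have "(a * v\<^sup>2 - a * (2 * v)) / (v\<^sup>2 * v\<^sup>2) = a / v\<^sup>2 * (1 - 2 / v)" if "v \<noteq> 0" for a v :: complex
      using that by (simp add: field_simps power2_eq_square)
    from this[OF norm_add_10_ge(3)[OF assms], of "exp w"] show ?thesis by (simp add: expfac_def)
  qed
  finally show ?thesis by (simp add: expfac_def[abs_def])
qed

context sector begin

text \<open>The switch occurs on the image of \<open>Re w = 3/2\<close>, halfway between the two
  integration lines. In each region the line in use stays at distance at least 1/2 in the
  \<open>w\<close>-plane, so the chosen Cauchy integral is bounded.\<close>

definition base :: "complex \<Rightarrow> complex" where
  "base z = (if z \<in> pw ` {w. Re w > 3/2}
     then exp (cauchy_int 1 z) * (1 + expfac (z powr (1 / of_real \<gamma>)))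
     else exp (cauchy_int 2 z))"

definition base_bound :: real where
  "base_bound = (\<Sum>n. 432 * 12 / (real n + 1)\<^sup>2)"

lemma pw_image_iff: "Re u > 0 \<Longrightarrow> S \<subseteq> {w. Re w > 0} \<Longrightarrow> pw u \<in> pw ` S \<longleftrightarrow> u \<in> S"
  using pw_eq_iff by blast

text \<open>On the overlap \<open>1 < Re u < 2\<close> the jump relation turns the outer formula
  into the inner one. The inner formula is thus valid beyond its defining region, just as the outer
  one is in \<open>base_outside\<close>.\<close>

lemma base_pw:
  assumes "Re u > 1"
  shows "base (pw u) = exp (cauchy_int 1 (pw u)) * (1 + expfac u)"
proof (cases "Re u > 3/2")
  case True
  then show ?thesis using assms by (simp add: base_def pw_powr_inverse)
next
  case False
  then have "pw u \<notin> pw ` {w. Re w > 3/2}" using assms by (subst pw_image_iff) auto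
  moreover have "cauchy_int 2 (pw u) = cauchy_int 1 (pw u) + logfac u"
    using cauchy_int_jump[of u] assms False by (simp add: algebra_simps)
  ultimately show ?thesis using assms False by (simp add: base_def exp_add exp_logfac)
qed

lemma base_outside:
  assumes "z \<notin> pw ` {w. Re w \<ge> 2}"
  shows "base z = exp (cauchy_int 2 z)"
proof (cases "z \<in> pw ` {w. Re w > 3/2}")
  case True
  then obtain u where u: "z = pw u" "Re u > 3/2" by auto
  with assms have "Re u < 2" by (cases "Re u < 2") auto
  moreover have "cauchy_int 2 (pw u) = cauchy_int 1 (pw u) + logfac u"
    using cauchy_int_jump[of u] u(2) \<open>Re u < 2\<close> by (simp add: algebra_simps)
  ultimately show ?thesis using u by (simp add: base_pw exp_add exp_logfac)
qed (simp add: base_def)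

lemma pw_image_line_disjoint:
  assumes "0 < c" "\<And>w. w \<in> S \<Longrightarrow> Re w > 0 \<and> Re w \<noteq> c"
  shows "pw ` S \<subseteq> - pw ` {w. Re w = c}"
  using assms pw_eq_iff by (auto; metis)

text \<open>Each of the two formulas is holomorphic on an open set larger than its defining region,
  and the two open sets cover the plane.\<close>

lemma holomorphic_base: "base holomorphic_on UNIV"
proof -
  let ?A = "pw ` {w. Re w > 1}" and ?B = "- pw ` {w. Re w \<ge> 2}"
  have A: "open ?A" by (rule open_pw_image) (auto simp: open_halfspace_Re_gt)
  have B: "open ?B"
    by (intro open_Compl closed_pw_image) (auto simp: closed_halfspace_Re_ge)
  have "(\<lambda>z. exp (cauchy_int 1 z) * (1 + expfac (z powr (1 / of_real \<gamma>)))) holomorphic_on ?A"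
  proof -
    have "?A \<subseteq> - pw ` {w. Re w = 1}" by (rule pw_image_line_disjoint) auto
    then have 1: "cauchy_int 1 holomorphic_on ?A"
      using holomorphic_on_subset[OF holomorphic_cauchy_int[of 1]] by auto
    have 2: "(\<lambda>z. z powr (1 / of_real \<gamma>)) holomorphic_on ?A"
    proof (intro holomorphic_intros)
      fix z assume "z \<in> ?A"
      then obtain w where "z = pw w" "Re w > 1" by auto
      then have "Re z > 0" using Re_pw_pos[of w] by simp
      then show "z \<notin> \<real>\<^sub>\<le>\<^sub>0" by (auto simp: complex_nonpos_Reals_iff)
    qed
    have "expfac \<circ> (\<lambda>z. z powr (1 / of_real \<gamma>)) holomorphic_on ?A"
      by (rule holomorphic_on_compose[OF 2 holomorphic_on_expfac]) (auto simp: pw_powr_inverse)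
    then show ?thesis using 1 by (intro holomorphic_intros) (auto simp: o_def)
  qed
  then have "base holomorphic_on ?A"
    by (rule holomorphic_transform) (auto simp: base_pw pw_powr_inverse)
  moreover have "base holomorphic_on ?B"
  proof -
    have "?B \<subseteq> - pw ` {w. Re w = 2}" by auto
    then have "cauchy_int 2 holomorphic_on ?B"
      using holomorphic_on_subset[OF holomorphic_cauchy_int[of 2]] by auto
    then have "(\<lambda>z. exp (cauchy_int 2 z)) holomorphic_on ?B" by (intro holomorphic_intros)
    then show ?thesis by (rule holomorphic_transform) (auto simp: base_outside)
  qed
  ultimately have "base holomorphic_on (?A \<union> ?B)" using A B by (rule holomorphic_on_Un)
  moreover have "?A \<union> ?B = UNIV" by force
  ultimately show ?thesis by simp
qed

section \<open>Bounds for the glued function and for its derivative at zeros\<close>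

lemma ball_half_Re: "u \<in> ball w (1/2) \<Longrightarrow> \<bar>Re u - Re w\<bar> < 1/2"
proof -
  assume "u \<in> ball w (1/2)"
  then have "norm (w - u) < 1/2" by (simp add: dist_norm)
  then show ?thesis using abs_Re_le_cmod[of "w - u"] unfolding minus_complex.sel by arith
qed

text \<open>Discs of radius 1/2 about the line \<open>Re w = 1\<close> do not reach
  \<open>Re w > 3/2\<close>, so their images omit \<open>pw u\<close> and
  \<open>kernel_bound\<close> applies uniformly.\<close>

lemma norm_cauchy_int_inside:
  assumes "Re u > 3/2"
  shows "norm (cauchy_int 1 (pw u)) \<le> base_bound"
  unfolding base_bound_def
proof (rule norm_cauchy_int_le)
  show "pw u \<notin> pw ` {w. Re w = 1}" using assms by (subst pw_image_iff) auto
  fix w assume w: "Re w = (1::real)"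
  have "Re v > 0 \<and> v \<noteq> u" if "v \<in> ball w (1/2)" for v
  proof -
    have "Re v > 0" "Re v < Re u" using assms w ball_half_Re[OF that] by arith+
    then show ?thesis by auto
  qed
  then have "pw u \<notin> pw ` ball w (1/2)" using assms by (subst pw_image_iff) auto
  then show "norm (pw' w / (pw w - pw u)) \<le> 12" using w by (intro kernel_bound) auto
qed auto

lemma norm_cauchy_int_outside:
  assumes "z \<notin> pw ` {w. Re w > 3/2}"
  shows "norm (cauchy_int 2 z) \<le> base_bound"
  unfolding base_bound_def
proof (rule norm_cauchy_int_le)
  show "z \<notin> pw ` {w. Re w = 2}" using assms by auto
  fix w assume w: "Re w = (2::real)"
  have "Re u > 3/2" if "u \<in> ball w (1/2)" for u
    using w ball_half_Re[OF that] by linarith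
  then have "z \<notin> pw ` ball w (1/2)" using assms by blast
  then show "norm (pw' w / (pw w - z)) \<le> 12" using w by (intro kernel_bound) auto
qed auto

lemma norm_exp_bounds:
  assumes "norm (v :: complex) \<le> K"
  shows "exp (- K) \<le> norm (exp v)" "norm (exp v) \<le> exp K"
  using assms abs_Re_le_cmod[of v] by auto

lemma norm_base_outside:
  assumes "z \<notin> pw ` {w. Re w > 3/2}"
  shows "exp (- base_bound) \<le> norm (base z)" "norm (base z) \<le> exp base_bound"
  using norm_exp_bounds[OF norm_cauchy_int_outside[OF assms]] assms by (simp_all add: base_def)

lemma norm_base_inside:
  assumes "Re u > 3/2"
  shows "exp (- base_bound) * norm (1 + expfac u) \<le> norm (base (pw u))"
    "norm (base (pw u)) \<le> exp base_bound * norm (1 + expfac u)"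
  using norm_exp_bounds[OF norm_cauchy_int_inside[OF assms]] assms
  by (auto simp: base_pw norm_mult intro!: mult_right_mono)

lemma base_eq_0_iff: "base z = 0 \<longleftrightarrow> (\<exists>u. Re u > 3/2 \<and> 1 + expfac u = 0 \<and> z = pw u)"
proof (cases "z \<in> pw ` {w. Re w > 3/2}")
  case True
  then obtain u where u: "z = pw u" "Re u > 3/2" by auto
  then have "base z = 0 \<longleftrightarrow> 1 + expfac u = 0" by (simp add: base_pw)
  moreover have "pw u = pw v \<longleftrightarrow> u = v" if "Re v > 3/2" for v using u that by (intro pw_eq_iff) auto
  ultimately show ?thesis using u by auto
next
  case False
  then show ?thesis by (auto simp: base_def)
qed

text \<open>Differentiate \<open>base \<circ> pw\<close> in two ways. The derivative of the
  exponential factor is multiplied by \<open>1 + expfac u = 0\<close>, and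
  \<open>expfac u = -1\<close> leaves \<open>1 - 2 / (u + 10)\<close>, of modulus at least 4/5.
  Finally \<open>norm (pw' u) \<le> 1\<close>.\<close>

lemma norm_deriv_base_ge:
  assumes u: "Re u > 3/2" "1 + expfac u = 0"
  shows "norm (deriv base (pw u)) \<ge> exp (- base_bound) / 2"
proof -
  have dbase: "(base has_field_derivative deriv base (pw u)) (at (pw u))"
    using holomorphic_derivI[OF holomorphic_base] by auto
  have "((\<lambda>w. base (pw w)) has_field_derivative deriv base (pw u) * pw' u) (at u)"
    using DERIV_chain2[OF dbase pw_has_field_derivative] u by auto
  moreover have "((\<lambda>w. base (pw w)) has_field_derivative exp (cauchy_int 1 (pw u)) * (- (1 - 2 / (u + 10)))) (at u)"
  proof -
    have "(\<lambda>w. exp (cauchy_int 1 (pw w))) holomorphic_on {w. Re w > 1}"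
    proof -
      have "cauchy_int 1 \<circ> pw holomorphic_on {w. Re w > 1}"
      proof (rule holomorphic_on_compose)
        show "pw holomorphic_on {w. Re w > 1}" by (rule holomorphic_on_pw) auto
        have "pw ` {w. Re w > 1} \<subseteq> - pw ` {w. Re w = 1}" by (rule pw_image_line_disjoint) auto
        then show "cauchy_int 1 holomorphic_on pw ` {w. Re w > 1}"
          using holomorphic_on_subset[OF holomorphic_cauchy_int[of 1]] by auto
      qed
      then show ?thesis by (intro holomorphic_intros) (simp add: o_def)
    qed
    from holomorphic_derivI[OF this open_halfspace_Re_gt, of u] u
    obtain A' where A': "((\<lambda>w. exp (cauchy_int 1 (pw w))) has_field_derivative A') (at u)" by auto
    have E: "((\<lambda>w. 1 + expfac w) has_field_derivative 0 + expfac u * (1 - 2 / (u + 10))) (at u)"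
      using u by (intro DERIV_add expfac_has_field_derivative) auto
    have "expfac u = - 1" using u(2) by (simp add: add_eq_0_iff)
    with DERIV_mult[OF A' E] u(2)
    have "((\<lambda>w. exp (cauchy_int 1 (pw w)) * (1 + expfac w)) has_field_derivative
        exp (cauchy_int 1 (pw u)) * (- (1 - 2 / (u + 10)))) (at u)"
      by (simp add: algebra_simps)
    then show ?thesis
      by (rule has_field_derivative_transform_within_open[OF _ open_halfspace_Re_gt[of 1]])
        (use u in \<open>auto simp: base_pw\<close>)
  qed
  ultimately have eq: "deriv base (pw u) * pw' u = exp (cauchy_int 1 (pw u)) * (- (1 - 2 / (u + 10)))"
    by (rule DERIV_unique)
  have "exp (- base_bound) * (1/2) \<le> norm (exp (cauchy_int 1 (pw u))) * norm (1 - 2 / (u + 10))"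
  proof (rule mult_mono)
    show "exp (- base_bound) \<le> norm (exp (cauchy_int 1 (pw u)))"
      using norm_exp_bounds(1)[OF norm_cauchy_int_inside[OF u(1)]] .
    have "norm (2 / (u + 10)) \<le> 2 / 10"
      unfolding norm_divide using norm_add_10_ge(2)[of u] u by (intro frac_le) auto
    then show "1/2 \<le> norm (1 - 2 / (u + 10))"
      using norm_triangle_ineq2[of 1 "2 / (u + 10)"] by simp
  qed auto
  also have "\<dots> = norm (deriv base (pw u) * pw' u)" unfolding eq by (simp add: norm_mult norm_minus_commute)
  also have "\<dots> \<le> norm (deriv base (pw u)) * 1"
    unfolding norm_mult using u complex_Re_le_cmod[of u] by (intro mult_left_mono norm_pw'_le) auto
  finally show ?thesis by simp
qed

end

section \<open>Order and partial fractions of entire functions\<close>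

lemma norm_le_max_modulus:
  assumes "F holomorphic_on UNIV" "norm z = r"
  shows "norm (F z) \<le> max_modulus F r"
proof -
  have "compact ((\<lambda>z. norm (F z)) ` sphere 0 r)"
    using assms(1) by (intro compact_continuous_image continuous_on_norm holomorphic_on_imp_continuous_on)
      (auto intro: holomorphic_on_subset)
  then have "bdd_above ((\<lambda>z. norm (F z)) ` sphere 0 r)" by (simp add: bounded_imp_bdd_above compact_imp_bounded)
  then show ?thesis unfolding max_modulus_def using assms(2) by (intro cSUP_upper) auto
qed

lemma max_modulus_le:
  assumes "0 \<le> r" "\<And>z. norm z = r \<Longrightarrow> norm (F z) \<le> B"
  shows "max_modulus F r \<le> B"
proof -
  have "of_real r \<in> sphere (0::complex) r" using assms(1) by simp
  then show ?thesis unfolding max_modulus_def using assms(2) by (intro cSUP_least) auto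
qed

text \<open>The iterated logarithm of \<open>exp (c * r powr \<rho>)\<close> is
  \<open>ln c + \<rho> * ln r\<close>, so the quotients are squeezed and the limes superior is a
  limit.\<close>

lemma entire_order_eqI:
  assumes \<rho>: "\<rho> > 0" and ab: "a > 0" "b > 0"
    and lo: "\<forall>\<^sub>F r in at_top. exp (a * r powr \<rho>) \<le> max_modulus F r"
    and up: "\<forall>\<^sub>F r in at_top. max_modulus F r \<le> exp (b * r powr \<rho>)"
  shows "entire_order F = ereal \<rho>"
proof -
  have L: "((\<lambda>r. (ln c + \<rho> * ln r) / ln r) \<longlongrightarrow> \<rho>) at_top" for c :: real
    by real_asymp
  have lnln: "ln (c * r powr \<rho>) = ln c + \<rho> * ln r" if "c > 0" "r > 1" for c r :: real
    using that by (simp add: ln_mult ln_powr)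
  have "((\<lambda>r. ln (ln (max_modulus F r)) / ln r) \<longlongrightarrow> \<rho>) at_top"
  proof (rule tendsto_sandwich[OF _ _ L[of a] L[of b]])
    show "\<forall>\<^sub>F r in at_top. (ln a + \<rho> * ln r) / ln r \<le> ln (ln (max_modulus F r)) / ln r"
      using lo eventually_gt_at_top[of 1]
    proof eventually_elim
      case (elim r)
      have pos: "0 < a * r powr \<rho>" using ab elim by simp
      have "a * r powr \<rho> \<le> ln (max_modulus F r)" 
        using elim by (metis exp_gt_zero ln_exp ln_le_cancel_iff order_less_le_trans)
      then have "ln (a * r powr \<rho>) \<le> ln (ln (max_modulus F r))" using pos by simp
      then show ?case using lnln[of a r] ab elim by (simp add: divide_right_mono)
    qed
    show "\<forall>\<^sub>F r in at_top. ln (ln (max_modulus F r)) / ln r \<le> (ln b + \<rho> * ln r) / ln r"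
      \<comment> \<open>The lower bound enters here too: it makes
        \<open>ln (max_modulus F r)\<close> positive, so that the outer logarithm is monotone at
        that point.\<close>
      using lo up eventually_gt_at_top[of 1]
    proof eventually_elim
      case (elim r)
      have pos: "0 < a * r powr \<rho>" using ab elim by simp
      have 1: "a * r powr \<rho> \<le> ln (max_modulus F r)" 
        using elim by (metis exp_gt_zero ln_exp ln_le_cancel_iff order_less_le_trans)
      have "max_modulus F r > 0" using elim(1) exp_gt_zero order_less_le_trans by blast
      then have "ln (max_modulus F r) \<le> b * r powr \<rho>" using elim(2) by (simp add: ln_le_cancel_iff[symmetric])
      then have "ln (ln (max_modulus F r)) \<le> ln (b * r powr \<rho>)" using pos 1 by simp
      then show ?case using lnln[of b r] ab elim by (simp add: divide_right_mono)
    qed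
  qed
  then have "((\<lambda>r. ereal (ln (ln (max_modulus F r)) / ln r)) \<longlongrightarrow> ereal \<rho>) at_top" by simp
  then show ?thesis unfolding entire_order_def by (rule lim_imp_Limsup[rotated]) simp
qed

text \<open>A constant function with a zero would have zero derivative there, so simplicity of the
  zeros excludes the constant case and the identity theorem applies.\<close>

lemma finite_zeros_bounded:
  assumes F: "F holomorphic_on UNIV" and simple: "\<And>t. F t = 0 \<Longrightarrow> deriv F t \<noteq> 0"
  shows "finite {t \<in> cball 0 R. F t = (0::complex)}"
proof (cases "\<exists>t. F t = 0")
  case True
  have "\<not> F constant_on UNIV"
  proof
    assume "F constant_on UNIV"
    then obtain c where "F = (\<lambda>_. c)" unfolding constant_on_def by auto
    then show False using True simple by auto
  qed
  then show ?thesis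
    by (intro holomorphic_compact_finite_zeros[OF F]) auto
qed auto

text \<open>The difference of both sides is a contour integral over \<open>norm \<zeta> = R k\<close>, which vanishes in the limit.\<close>

lemma inverse_entire_partial_fractions:
  fixes F :: "complex \<Rightarrow> complex" and R m :: "nat \<Rightarrow> real"
  assumes F: "F holomorphic_on UNIV" and simple: "\<And>t. F t = 0 \<Longrightarrow> deriv F t \<noteq> 0"
    and sm: "(\<lambda>t. 1 / norm (deriv F t)) summable_on {t. F t = 0}"
    and R: "filterlim R at_top sequentially" and m: "filterlim m at_top sequentially"
    and lower: "\<forall>\<^sub>F k in sequentially. \<forall>\<zeta>. norm \<zeta> = R k \<longrightarrow> m k \<le> norm (F \<zeta>)"
    and z: "F z \<noteq> 0"
  shows "((\<lambda>t. 1 / (deriv F t * (z - t))) has_sum (1 / F z)) {t. F t = 0}"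
proof -
  define T where "T = {t. F t = 0}"
  define f where "f t = 1 / (deriv F t * (z - t))" for t
  have contF: "continuous_on UNIV F" using F by (rule holomorphic_on_imp_continuous_on)
  have "open (- T)"
    unfolding T_def using contF by (intro open_Compl closed_Collect_eq continuous_on_const) auto
  then obtain \<delta> where \<delta>: "\<delta> > 0" "ball z \<delta> \<subseteq> - T" using z by (auto simp: T_def open_contains_ball)
  have "f summable_on T"
  proof (rule abs_summable_summable)
    have "(\<lambda>t. 1 / norm (deriv F t) * (1 / \<delta>)) summable_on T"
      using sm unfolding T_def by (rule summable_on_cmult_left)
    then show "(\<lambda>t. norm (f t)) summable_on T"
    proof (rule summable_on_comparison_test)
      fix t assume "t \<in> T"
      then have "\<delta> \<le> norm (z - t)" using \<delta> by (force simp: dist_norm)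
      then have "1 / norm (deriv F t) * (1 / norm (z - t)) \<le> 1 / norm (deriv F t) * (1 / \<delta>)"
        using \<delta>(1) by (intro mult_left_mono divide_left_mono) (auto intro!: mult_pos_pos)
      then show "norm (f t) \<le> 1 / norm (deriv F t) * (1 / \<delta>)"
        by (simp add: f_def norm_divide norm_mult)
    qed auto
  qed
  then have S: "(f has_sum infsum f T) T" by simp
  have fin: "finite (T \<inter> cball 0 r)" for r
    using finite_zeros_bounded[OF F simple, of r] by (simp add: T_def Int_def conj_commute)
  have fin': "finite (T \<inter> ball 0 r)" for r
    by (rule finite_subset[OF _ fin[of r]]) auto
  \<comment> \<open>The discs of radius \<open>R k\<close> eventually contain any finite set of
    zeros, so the unordered sum can be computed as a limit of sums over discs.\<close>
  have "filterlim (\<lambda>k. T \<inter> ball 0 (R k)) (finite_subsets_at_top T) sequentially"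
    unfolding filterlim_finite_subsets_at_top
  proof (intro allI impI)
    fix X assume X: "finite X \<and> X \<subseteq> T"
    then obtain B where "\<forall>x\<in>X. norm x \<le> B" using finite_imp_bounded bounded_iff by metis
    moreover have "\<forall>\<^sub>F k in sequentially. R k > B" using R by (simp add: filterlim_at_top_dense)
    ultimately show "\<forall>\<^sub>F k in sequentially. finite (T \<inter> ball 0 (R k)) \<and> X \<subseteq> T \<inter> ball 0 (R k) \<and> T \<inter> ball 0 (R k) \<subseteq> T"
      using X fin' by (auto elim!: eventually_mono)
  qed
  with S have lim1: "(\<lambda>k. \<Sum>t\<in>T \<inter> ball 0 (R k). f t) \<longlonglongrightarrow> infsum f T"
    unfolding has_sum_def by (rule filterlim_compose)
  \<comment> \<open>The reciprocal \<open>1 / g\<close> has a simple pole at \<open>z\<close> with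
    residue \<open>1 / F z\<close> and simple poles at the zeros \<open>t\<close> of
    \<open>F\<close> with residues \<open>- f t\<close>.\<close>
  define g where "g \<zeta> = F \<zeta> * (\<zeta> - z)" for \<zeta>
  have holg: "g holomorphic_on UNIV" unfolding g_def[abs_def] using F by (intro holomorphic_intros)
  have g0: "g \<zeta> = 0 \<longleftrightarrow> \<zeta> \<in> insert z T" for \<zeta> by (auto simp: g_def T_def)
  have dg: "(g has_field_derivative deriv F \<zeta> * (\<zeta> - z) + F \<zeta>) (at \<zeta>)" for \<zeta>
    unfolding g_def[abs_def] using holomorphic_derivI[OF F open_UNIV, of \<zeta>]
    by (auto intro!: derivative_eq_intros)
  have res: "residue (\<lambda>\<zeta>. 1 / g \<zeta>) p = 1 / (deriv F p * (p - z) + F p)" if "p \<in> insert z T" for p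
  proof (rule residue_simple_pole_deriv[OF _ holg open_UNIV connected_UNIV _ dg])
    show "deriv F p * (p - z) + F p \<noteq> 0" using that z simple by (auto simp: T_def)
  qed (use that g0 in auto)
  have main: "\<forall>\<^sub>F k in sequentially. norm ((\<Sum>t\<in>T \<inter> ball 0 (R k). f t) - 1 / F z) \<le> 2 / m k"
    using lower filterlim_at_top_dense[THEN iffD1, OF R, rule_format, of "2 * norm z + 1"]
      filterlim_at_top_dense[THEN iffD1, OF m, rule_format, of 0]
  proof eventually_elim
    case (elim k)
    define r where "r = R k"
    have r: "r > 0" "norm z < r" "norm z \<le> r / 2" using elim norm_ge_zero[of z] unfolding r_def by linarith+
    have Fr: "m k \<le> norm (F \<zeta>)" if "norm \<zeta> = r" for \<zeta> using elim that by (simp add: r_def)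
    \<comment> \<open>The residue theorem is used on a slightly larger disc with finitely many
      poles; those outside the circle have winding number 0.\<close>
    let ?pts = "insert z (T \<inter> ball 0 (r + 1))"
    have on: "g \<zeta> \<noteq> 0" if "norm \<zeta> = r" for \<zeta>
      using Fr[OF that] elim(3) r that by (auto simp: g_def)
    have "contour_integral (circlepath 0 r) (\<lambda>\<zeta>. 1 / g \<zeta>)
       = 2 * pi * \<i> * (\<Sum>p\<in>?pts. winding_number (circlepath 0 r) p * residue (\<lambda>\<zeta>. 1 / g \<zeta>) p)"
    proof (rule Residue_theorem[where S = "ball 0 (r + 1)"])
      show "(\<lambda>\<zeta>. 1 / g \<zeta>) holomorphic_on ball 0 (r + 1) - ?pts"
        using g0 by (intro holomorphic_intros holomorphic_on_subset[OF holg]) auto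
      show "path_image (circlepath 0 r) \<subseteq> ball 0 (r + 1) - ?pts"
        using r on g0 by (auto simp: T_def)
      show "\<forall>\<zeta>. \<zeta> \<notin> ball 0 (r + 1) \<longrightarrow> winding_number (circlepath 0 r) \<zeta> = 0"
        using r by (auto intro!: winding_number_zero_outside[where s = "cball 0 r"])
    qed (use fin' in auto)
    also have "(\<Sum>p\<in>?pts. winding_number (circlepath 0 r) p * residue (\<lambda>\<zeta>. 1 / g \<zeta>) p)
       = (\<Sum>p\<in>insert z (T \<inter> ball 0 r). residue (\<lambda>\<zeta>. 1 / g \<zeta>) p)"
    proof (rule sum.mono_neutral_cong_right)
      show "insert z (T \<inter> ball 0 r) \<subseteq> ?pts" by auto
      show "\<forall>p\<in>?pts - insert z (T \<inter> ball 0 r). winding_number (circlepath 0 r) p * residue (\<lambda>\<zeta>. 1 / g \<zeta>) p = 0"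
      proof
        fix p assume p: "p \<in> ?pts - insert z (T \<inter> ball 0 r)"
        then have "g p = 0" "\<not> norm p < r" using g0 by auto
        with on have "norm p > r" by (metis linorder_neqE_linordered_idom)
        then have "winding_number (circlepath 0 r) p = 0"
          using r by (intro winding_number_zero_outside[where s = "cball 0 r"]) auto
        then show "winding_number (circlepath 0 r) p * residue (\<lambda>\<zeta>. 1 / g \<zeta>) p = 0" by simp
      qed
      fix p assume "p \<in> insert z (T \<inter> ball 0 r)"
      then have "norm p < r" using r by auto
      then show "winding_number (circlepath 0 r) p * residue (\<lambda>\<zeta>. 1 / g \<zeta>) p = residue (\<lambda>\<zeta>. 1 / g \<zeta>) p"
        using winding_number_circlepath[of p 0 r] by simp
    qed (use fin' in auto)
    also have "\<dots> = 1 / F z + (\<Sum>p\<in>T \<inter> ball 0 r. residue (\<lambda>\<zeta>. 1 / g \<zeta>) p)"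
      using z fin' res[of z] by (subst sum.insert) (auto simp: T_def)
    also have "(\<Sum>p\<in>T \<inter> ball 0 r. residue (\<lambda>\<zeta>. 1 / g \<zeta>) p) = (\<Sum>p\<in>T \<inter> ball 0 r. - f p)"
    proof (intro sum.cong refl)
      fix p assume "p \<in> T \<inter> ball 0 r"
      then have "residue (\<lambda>\<zeta>. 1 / g \<zeta>) p = 1 / (deriv F p * (p - z))" using res[of p] by (simp add: T_def)
      also have "deriv F p * (p - z) = - (deriv F p * (z - p))" by (simp add: algebra_simps)
      finally show "residue (\<lambda>\<zeta>. 1 / g \<zeta>) p = - f p" unfolding f_def by simp
    qed
    finally have eq: "contour_integral (circlepath 0 r) (\<lambda>\<zeta>. 1 / g \<zeta>)
       = 2 * pi * \<i> * (1 / F z - (\<Sum>t\<in>T \<inter> ball 0 r. f t))" by (simp add: sum_negf)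
    have "norm (contour_integral (circlepath 0 r) (\<lambda>\<zeta>. 1 / g \<zeta>)) \<le> 1 / (m k * (r / 2)) * (2 * pi * r)"
    proof (rule has_contour_integral_bound_circlepath[OF has_contour_integral_integral])
      show "(\<lambda>\<zeta>. 1 / g \<zeta>) contour_integrable_on circlepath 0 r"
        using on r by (intro contour_integrable_continuous_circlepath continuous_intros
            holomorphic_on_imp_continuous_on holomorphic_on_subset[OF holg]) auto
      fix \<zeta> :: complex assume "norm (\<zeta> - 0) = r"
      then have n: "norm \<zeta> = r" by simp
      have "r / 2 \<le> norm (\<zeta> - z)" using norm_triangle_ineq2[of \<zeta> z] n r by linarith
      then have "m k * (r / 2) \<le> norm (g \<zeta>)"
        unfolding g_def norm_mult using Fr[OF n] elim r by (intro mult_mono) auto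
      then show "norm (1 / g \<zeta>) \<le> 1 / (m k * (r / 2))"
        unfolding norm_divide using elim r by (intro frac_le mult_pos_pos) auto
    qed (use elim r in auto)
    also have "\<dots> = 2 * pi * (2 / m k)" using r elim by (simp add: field_simps)
    finally have "2 * pi * norm (1 / F z - (\<Sum>t\<in>T \<inter> ball 0 r. f t)) \<le> 2 * pi * (2 / m k)"
      unfolding eq by (simp add: norm_mult)
    then have "norm (1 / F z - (\<Sum>t\<in>T \<inter> ball 0 r. f t)) \<le> 2 / m k"
      by (subst (asm) mult_le_cancel_left_pos) auto
    then show ?case by (simp add: norm_minus_commute r_def)
  qed
  have "(\<lambda>k. 2 / m k) \<longlonglongrightarrow> 0"
    by (rule tendsto_divide_0[OF tendsto_const filterlim_at_top_imp_at_infinity[OF m]])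
  then have "(\<lambda>k. (\<Sum>t\<in>T \<inter> ball 0 (R k). f t) - 1 / F z) \<longlonglongrightarrow> 0"
    by (rule Lim_null_comparison[OF main])
  then have "(\<lambda>k. \<Sum>t\<in>T \<inter> ball 0 (R k). f t) \<longlonglongrightarrow> 1 / F z" by (simp add: LIM_zero_iff)
  then have "infsum f T = 1 / F z" using lim1 LIMSEQ_unique by blast
  with S show ?thesis unfolding T_def f_def[abs_def] by simp
qed

section \<open>The function of the theorem\<close>

context sector begin

text \<open>Chosen so that \<open>\<gamma> * deg \<ge> 2\<close>: at \<open>pw u\<close> the
  polynomial then grows at least like the square of \<open>norm u\<close>, matching
  \<open>summable_on_expfac_zeros\<close>.\<close>

definition deg :: nat where "deg = nat \<lceil>2 / \<gamma>\<rceil>"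

text \<open>Distinct points on the positive axis, hence inside the angle. Their modulus is at most
  1/2, while every zero of \<open>base\<close> has modulus at least 1, so all zeros of the product
  are simple.\<close>

definition node :: "nat \<Rightarrow> complex" where "node j = of_real (real j / (2 * real deg))"

definition nodal :: "complex \<Rightarrow> complex" where "nodal z = (\<Prod>j\<in>{1..deg}. z - node j)"

definition entire_fn :: "complex \<Rightarrow> complex" where "entire_fn z = nodal z * base z"

lemma deg: "1 \<le> deg" "2 \<le> \<gamma> * real deg"
proof -
  have "0 < 2 / \<gamma>" using \<gamma>_pos by simp
  then show "1 \<le> deg" unfolding deg_def by linarith
  have "2 / \<gamma> \<le> real deg" unfolding deg_def by linarith
  then show "2 \<le> \<gamma> * real deg" using \<gamma>_pos by (simp add: field_simps)
qed

lemma norm_node: "j \<in> {1..deg} \<Longrightarrow> 0 < norm (node j) \<and> norm (node j) \<le> 1/2"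
  by (auto simp: node_def norm_divide field_simps)

lemma node_eq_iff: "node i = node j \<longleftrightarrow> i = j"
  using deg(1) by (simp add: node_def)

lemma nodal_bounds:
  assumes "1 \<le> norm z"
  shows "(norm z / 2) ^ deg \<le> norm (nodal z)" "norm (nodal z) \<le> (2 * norm z) ^ deg"
proof -
  have n: "norm (nodal z) = (\<Prod>j\<in>{1..deg}. norm (z - node j))"
    by (simp add: nodal_def prod_norm)
  have j: "norm z / 2 \<le> norm (z - node j)" "norm (z - node j) \<le> 2 * norm z" if "j \<in> {1..deg}" for j
    using norm_node[OF that] assms norm_triangle_ineq2[of z "node j"] norm_triangle_ineq4[of z "node j"]
    by linarith+
  have "(\<Prod>j\<in>{1..deg}. norm z / 2) \<le> (\<Prod>j\<in>{1..deg}. norm (z - node j))"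
    using j by (intro prod_mono) auto
  then show "(norm z / 2) ^ deg \<le> norm (nodal z)" by (simp add: n)
  have "(\<Prod>j\<in>{1..deg}. norm (z - node j)) \<le> (\<Prod>j\<in>{1..deg}. 2 * norm z)"
    using j by (intro prod_mono) auto
  then show "norm (nodal z) \<le> (2 * norm z) ^ deg" by (simp add: n)
qed

lemma nodal_eq_0_iff: "nodal z = 0 \<longleftrightarrow> z \<in> node ` {1..deg}"
  by (auto simp: nodal_def)

lemma holomorphic_nodal: "nodal holomorphic_on S"
  unfolding nodal_def[abs_def] by (intro holomorphic_intros)

lemma holomorphic_entire_fn: "entire_fn holomorphic_on UNIV"
  unfolding entire_fn_def[abs_def] by (intro holomorphic_intros holomorphic_nodal holomorphic_base)

lemma deriv_entire_fn: "deriv entire_fn z = deriv nodal z * base z + nodal z * deriv base z"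
proof -
  have "(nodal has_field_derivative deriv nodal z) (at z)" "(base has_field_derivative deriv base z) (at z)"
    using holomorphic_derivI[OF holomorphic_nodal open_UNIV] holomorphic_derivI[OF holomorphic_base open_UNIV] by auto
  from DERIV_mult[OF this] show ?thesis
    unfolding entire_fn_def[abs_def] by (intro DERIV_imp_deriv) (simp add: algebra_simps)
qed

lemma base_zeros: "{z. base z = 0} = pw ` expfac_zeros"
  using base_eq_0_iff by (auto simp: expfac_zeros_def)

lemma norm_expfac_zero_ge: "u \<in> expfac_zeros \<Longrightarrow> 1 \<le> norm u"
  using complex_Re_le_cmod[of u] by (auto simp: expfac_zeros_def)

lemma norm_pw_ge_1: "1 \<le> norm u \<Longrightarrow> 1 \<le> norm (pw u)"
  using \<gamma>_pos by (simp add: norm_pw ge_one_powr_ge_zero)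

lemma base_node_nonzero: "j \<in> {1..deg} \<Longrightarrow> base (node j) \<noteq> 0"
proof
  assume j: "j \<in> {1..deg}" "base (node j) = 0"
  then have "node j \<in> pw ` expfac_zeros" using base_zeros by blast
  then show False using norm_node[OF j(1)] norm_pw_ge_1 norm_expfac_zero_ge by force
qed

lemma entire_fn_zeros: "{z. entire_fn z = 0} = node ` {1..deg} \<union> pw ` expfac_zeros"
  using base_zeros nodal_eq_0_iff by (auto simp: entire_fn_def)

lemma deriv_entire_fn_node:
  assumes j: "j \<in> {1..deg}"
  shows "deriv entire_fn (node j) \<noteq> 0"
proof -
  \<comment> \<open>By the product rule, the derivative of \<open>nodal\<close> at a node is the
    product of the remaining factors.\<close>
  define Q where "Q z = (\<Prod>i\<in>{1..deg} - {j}. z - node i)" for z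
  have "nodal z = (z - node j) * Q z" for z
    unfolding nodal_def Q_def using j by (subst prod.remove[of _ j]) auto
  then have eq: "nodal = (\<lambda>z. (z - node j) * Q z)" by auto
  have "Q holomorphic_on UNIV" unfolding Q_def[abs_def] by (intro holomorphic_intros)
  then have "(Q has_field_derivative deriv Q (node j)) (at (node j))"
    using holomorphic_derivI by blast
  then have "(nodal has_field_derivative Q (node j)) (at (node j))"
    unfolding eq by (auto intro!: derivative_eq_intros)
  then have "deriv nodal (node j) = Q (node j)" by (rule DERIV_imp_deriv)
  moreover have "Q (node j) \<noteq> 0" using node_eq_iff by (auto simp: Q_def)
  moreover have "nodal (node j) = 0" using j by (simp add: nodal_eq_0_iff)
  ultimately show ?thesis using base_node_nonzero[OF j] by (simp add: deriv_entire_fn)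
qed

text \<open>Since \<open>base\<close> vanishes at \<open>pw u\<close>, only
  \<open>nodal * deriv base\<close> survives. The derivative is bounded below, and the degree makes
  the polynomial contribute the square of \<open>norm u\<close>.\<close>

lemma norm_deriv_entire_fn_ge:
  assumes u: "u \<in> expfac_zeros"
  shows "norm (deriv entire_fn (pw u)) \<ge> exp (- base_bound) / 2 ^ (deg + 1) * (norm u)\<^sup>2"
proof -
  have n1: "1 \<le> norm u" by (rule norm_expfac_zero_ge[OF u])
  have "base (pw u) = 0" using base_zeros u by blast
  then have "norm (deriv entire_fn (pw u)) = norm (nodal (pw u)) * norm (deriv base (pw u))"
    by (simp add: deriv_entire_fn norm_mult)
  also have "\<dots> \<ge> (norm (pw u) / 2) ^ deg * (exp (- base_bound) / 2)"
    using u nodal_bounds(1)[OF norm_pw_ge_1[OF n1]] norm_deriv_base_ge[of u]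
    by (intro mult_mono) (auto simp: expfac_zeros_def)
  finally have 1: "(norm (pw u) / 2) ^ deg * (exp (- base_bound) / 2) \<le> norm (deriv entire_fn (pw u))" .
  have "norm u powr 2 \<le> norm u powr (\<gamma> * real deg)" using n1 deg by (intro powr_mono) auto
  also have "\<dots> = norm (pw u) ^ deg"
  proof -
    have "norm u powr \<gamma> > 0" using n1 by force
    then show ?thesis by (simp only: norm_pw powr_powr[symmetric] powr_realpow)
  qed
  finally have "(norm u)\<^sup>2 \<le> norm (pw u) ^ deg" using n1 by (simp add: powr_realpow[of "norm u" 2, symmetric])
  then have "exp (- base_bound) / 2 ^ (deg + 1) * (norm u)\<^sup>2 \<le> exp (- base_bound) / 2 ^ (deg + 1) * norm (pw u) ^ deg"
    by (intro mult_left_mono) auto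
  also have "\<dots> = (norm (pw u) / 2) ^ deg * (exp (- base_bound) / 2)"
    by (simp add: power_divide mult.commute)
  finally show ?thesis using 1 by linarith
qed

section \<open>The zeros: simplicity, summability and location\<close>

lemma entire_fn_simple_zeros: "entire_fn t = 0 \<Longrightarrow> deriv entire_fn t \<noteq> 0"
proof -
  assume "entire_fn t = 0"
  then consider j where "j \<in> {1..deg}" "t = node j" | u where "u \<in> expfac_zeros" "t = pw u"
    using entire_fn_zeros by blast
  then show ?thesis
  proof cases
    case 1
    then show ?thesis using deriv_entire_fn_node by simp
  next
    case 2
    then have "0 < exp (- base_bound) / 2 ^ (deg + 1) * (norm u)\<^sup>2"
      using norm_expfac_zero_ge[of u] by (intro mult_pos_pos zero_less_power divide_pos_pos) auto
    then show ?thesis using norm_deriv_entire_fn_ge[of u] 2 by auto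
  qed
qed

lemma summable_inverse_deriv_entire_fn: "(\<lambda>t. 1 / norm (deriv entire_fn t)) summable_on {t. entire_fn t = 0}"
proof -
  have inj: "inj_on pw expfac_zeros"
    using pw_eq_iff by (auto simp: inj_on_def expfac_zeros_def)
  define c where "c = exp (- base_bound) / 2 ^ (deg + 1)"
  have c: "c > 0" by (simp add: c_def)
  have "(\<lambda>u. 1 / (norm u)\<^sup>2 * (1 / c)) summable_on expfac_zeros"
    by (rule summable_on_cmult_left[OF summable_on_expfac_zeros])
  then have "(\<lambda>u. 1 / norm (deriv entire_fn (pw u))) summable_on expfac_zeros"
  proof (rule summable_on_comparison_test)
    fix u assume u: "u \<in> expfac_zeros"
    have "0 < c * (norm u)\<^sup>2"
      using norm_expfac_zero_ge[OF u] c by (intro mult_pos_pos zero_less_power) auto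
    then have "1 / norm (deriv entire_fn (pw u)) \<le> 1 / (c * (norm u)\<^sup>2)"
      using norm_deriv_entire_fn_ge[OF u] unfolding c_def[symmetric] by (intro frac_le) auto
    then show "1 / norm (deriv entire_fn (pw u)) \<le> 1 / (norm u)\<^sup>2 * (1 / c)" by (simp add: mult.commute)
  qed auto
  then have "(\<lambda>t. 1 / norm (deriv entire_fn t)) summable_on pw ` expfac_zeros"
    by (simp add: summable_on_reindex[OF inj] o_def)
  moreover have "(\<lambda>t. 1 / norm (deriv entire_fn t)) summable_on node ` {1..deg}"
    by (rule summable_on_finite) auto
  ultimately show ?thesis unfolding entire_fn_zeros by (intro summable_on_union)
qed

text \<open>The argument of \<open>pw u\<close> is \<open>\<gamma>\<close> times that of
  \<open>u\<close>, which lies strictly between -pi/2 and pi/2.\<close>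

lemma pw_in_sector:
  assumes "Re u > 0"
  shows "\<exists>r \<phi>. 0 < r \<and> - pi * \<gamma> / 2 < \<phi> \<and> \<phi> < - pi * \<gamma> / 2 + pi * \<gamma>
      \<and> pw u = complex_of_real r * exp (\<i> * complex_of_real \<phi>)"
proof (intro exI conjI)
  have u0: "u \<noteq> 0" using assms by auto
  have a: "\<bar>Im (Ln u)\<bar> < pi / 2" using assms Re_Ln_pos_lt_imp[of u] u0 by auto
  have "\<gamma> * \<bar>Im (Ln u)\<bar> < \<gamma> * (pi / 2)" using a \<gamma>_pos by (rule mult_strict_left_mono)
  then have b: "\<bar>\<gamma> * Im (Ln u)\<bar> < pi * \<gamma> / 2" using \<gamma>_pos by (simp add: abs_mult mult.commute)
  show "0 < exp (\<gamma> * Re (Ln u))" by simp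
  show "- pi * \<gamma> / 2 < \<gamma> * Im (Ln u)" "\<gamma> * Im (Ln u) < - pi * \<gamma> / 2 + pi * \<gamma>" using b by (simp_all add: abs_less_iff)
  have "of_real \<gamma> * Ln u = of_real (\<gamma> * Re (Ln u)) + \<i> * of_real (\<gamma> * Im (Ln u))"
    by (simp add: complex_eq_iff)
  from arg_cong[OF this, of exp]
  show "pw u = complex_of_real (exp (\<gamma> * Re (Ln u))) * exp (\<i> * complex_of_real (\<gamma> * Im (Ln u)))"
    by (simp only: pw_eq_exp[OF u0] exp_add exp_of_real)
qed

lemma entire_fn_zeros_in_sector:
  assumes "entire_fn t = 0"
  shows "\<exists>r \<phi>. 0 < r \<and> - pi * \<gamma> / 2 < \<phi> \<and> \<phi> < - pi * \<gamma> / 2 + pi * \<gamma>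
      \<and> t = complex_of_real r * exp (\<i> * complex_of_real \<phi>)"
proof -
  consider j where "j \<in> {1..deg}" "t = node j" | u where "u \<in> expfac_zeros" "t = pw u"
    using assms entire_fn_zeros by blast
  then show ?thesis
  proof cases
    case 1
    then show ?thesis using \<gamma>_pos
      by (intro exI[of _ "real j / (2 * real deg)"] exI[of _ 0]) (auto simp: node_def)
  next
    case 2
    then show ?thesis using pw_in_sector[of u] by (simp add: expfac_zeros_def)
  qed
qed

text \<open>Inside the angle these circles are images of arcs of
  \<open>norm w = (2 * k + 1) * pi\<close>, where \<open>1 + expfac\<close> is at least 1/2 in
  modulus. Outside the gluing curve \<open>base\<close> is bounded below anyway.\<close>

lemma entire_fn_lower_on_circles:
  "\<forall>\<^sub>F k in sequentially. \<forall>\<zeta>. norm \<zeta> = ((2 * real k + 1) * pi) powr \<gamma> \<longrightarrow>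
     exp (- base_bound) / 2 * (((2 * real k + 1) * pi) powr \<gamma> / 2) ^ deg \<le> norm (entire_fn \<zeta>)"
  using norm_one_plus_expfac_ge
proof (eventually_elim, intro allI impI)
  fix k and \<zeta> :: complex
  define X where "X = (2 * real k + 1) * pi"
  assume *: "\<forall>w. norm w = (2 * real k + 1) * pi \<longrightarrow> Re w > 0 \<longrightarrow> norm (1 + expfac w) \<ge> 1/2"
    and \<zeta>: "norm \<zeta> = ((2 * real k + 1) * pi) powr \<gamma>"
  have "1 * 1 \<le> X" unfolding X_def using pi_ge_two by (intro mult_mono) auto
  then have X1: "1 \<le> X" by simp
  have \<zeta>1: "1 \<le> norm \<zeta>" using \<zeta> X1 \<gamma>_pos by (simp add: X_def ge_one_powr_ge_zero)
  have "exp (- base_bound) / 2 \<le> norm (base \<zeta>)"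
  proof (cases "\<zeta> \<in> pw ` {w. Re w > 3/2}")
    case True
    then obtain w where w: "\<zeta> = pw w" "Re w > 3/2" by auto
    have "norm w powr \<gamma> = X powr \<gamma>" using \<zeta> w by (simp add: norm_pw X_def)
    then have "norm w = X" using \<gamma>_pos X1
      by (metis norm_ge_zero order_trans powr_less_mono2 less_irrefl linorder_neqE_linordered_idom zero_le_one)
    then have "1/2 \<le> norm (1 + expfac w)" using * w by (auto simp: X_def)
    then have "exp (- base_bound) * (1/2) \<le> exp (- base_bound) * norm (1 + expfac w)"
      by (intro mult_left_mono) auto
    then show ?thesis using norm_base_inside(1)[OF w(2)] unfolding w(1) by linarith
  next
    case False
    then show ?thesis using norm_base_outside(1)[of \<zeta>] exp_gt_zero[of "- base_bound"] by linarith
  qed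
  with nodal_bounds(1)[OF \<zeta>1]
  have "(norm \<zeta> / 2) ^ deg * (exp (- base_bound) / 2) \<le> norm (nodal \<zeta>) * norm (base \<zeta>)"
    by (intro mult_mono) auto
  then show "exp (- base_bound) / 2 * (((2 * real k + 1) * pi) powr \<gamma> / 2) ^ deg \<le> norm (entire_fn \<zeta>)"
    by (simp only: entire_fn_def norm_mult \<zeta> mult.commute)
qed

section \<open>The expansion of the reciprocal, and the order\<close>

lemma entire_fn_partial_fractions:
  assumes "entire_fn z \<noteq> 0"
  shows "((\<lambda>t. 1 / (deriv entire_fn t * (z - t))) has_sum (1 / entire_fn z)) {t. entire_fn t = 0}"
proof (rule inverse_entire_partial_fractions[OF holomorphic_entire_fn entire_fn_simple_zeros summable_inverse_deriv_entire_fn _ _ entire_fn_lower_on_circles assms])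
  have "filterlim (\<lambda>k. (2 * real k + 1) * pi) at_top sequentially" by real_asymp
  then show R: "filterlim (\<lambda>k. ((2 * real k + 1) * pi) powr \<gamma>) at_top sequentially"
    by (rule filterlim_compose[OF real_powr_at_top[OF \<gamma>_pos]])
  have "filterlim (\<lambda>x::real. x ^ deg) at_top at_top"
    using deg(1) by (intro filterlim_pow_at_top filterlim_ident) auto
  moreover have "filterlim (\<lambda>k. 1/2 * ((2 * real k + 1) * pi) powr \<gamma>) at_top sequentially"
    by (rule filterlim_tendsto_pos_mult_at_top[OF tendsto_const _ R]) simp
  ultimately have "filterlim (\<lambda>k. (1/2 * ((2 * real k + 1) * pi) powr \<gamma>) ^ deg) at_top sequentially"
    by (rule filterlim_compose)
  then have "filterlim (\<lambda>k. exp (- base_bound) / 2 * (1/2 * ((2 * real k + 1) * pi) powr \<gamma>) ^ deg) at_top sequentially"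
    by (intro filterlim_tendsto_pos_mult_at_top[OF tendsto_const]) auto
  then show "filterlim (\<lambda>k. exp (- base_bound) / 2 * (((2 * real k + 1) * pi) powr \<gamma> / 2) ^ deg) at_top sequentially"
    by simp
qed

lemma norm_base_le: "norm (base z) \<le> 2 * exp base_bound * exp (norm z powr (1 / \<gamma>))"
proof -
  have e1: "1 \<le> exp (norm z powr (1 / \<gamma>))" by simp
  show ?thesis
  proof (cases "z \<in> pw ` {w. Re w > 3/2}")
    case True
    then obtain w where w: "z = pw w" "Re w > 3/2" by auto
    have nz: "norm z powr (1 / \<gamma>) = norm w" using w \<gamma>_pos by (simp add: norm_pw powr_powr)
    have "norm (expfac w) \<le> exp (Re w) / 1"
      unfolding norm_expfac using norm_add_10_ge(2)[of w] w by (intro divide_left_mono) (auto simp: one_le_power)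
    also have "\<dots> \<le> exp (norm w)" using complex_Re_le_cmod[of w] by simp
    finally have "norm (1 + expfac w) \<le> 2 * exp (norm z powr (1 / \<gamma>))"
      using norm_triangle_ineq[of 1 "expfac w"] e1 unfolding nz norm_one by linarith
    then have "exp base_bound * norm (1 + expfac w) \<le> exp base_bound * (2 * exp (norm z powr (1 / \<gamma>)))"
      by (intro mult_left_mono) auto
    also have "\<dots> = 2 * exp base_bound * exp (norm z powr (1 / \<gamma>))" by simp
    finally show ?thesis using norm_base_inside(2)[OF w(2)] unfolding w(1) by linarith
  next
    case False
    have "exp base_bound * 1 \<le> exp base_bound * (2 * exp (norm z powr (1 / \<gamma>)))"
      using e1 by (intro mult_left_mono; (linarith | simp))
    also have "\<dots> = 2 * exp base_bound * exp (norm z powr (1 / \<gamma>))" by simp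
    finally show ?thesis using norm_base_outside(2)[OF False] by linarith
  qed
qed

text \<open>The lower bound is attained on the positive axis, where \<open>expfac\<close> is
  positive and almost as large as \<open>exp (r powr (1 / \<gamma>))\<close>. The upper bound
  combines \<open>norm_base_le\<close> with the polynomial bound.\<close>

lemma entire_order_entire_fn: "entire_order entire_fn = ereal (1 / \<gamma>)"
proof (rule entire_order_eqI[where a = "1/2" and b = 2])
  have X: "filterlim (\<lambda>r. r powr (1 / \<gamma>)) at_top at_top"
    using \<gamma>_pos by (intro real_powr_at_top) simp
  have "\<forall>\<^sub>F x in at_top. exp (1/2 * x) \<le> exp (- base_bound) * (exp x / (x + 10)\<^sup>2)"
    by real_asymp
  then have "\<forall>\<^sub>F x in at_top. exp (1/2 * x) \<le> exp (- base_bound) * (exp x / (x + 10)\<^sup>2) \<and> x > 3/2"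
    using eventually_gt_at_top[of "3/2"] by eventually_elim auto
  from eventually_compose_filterlim[OF this X] eventually_ge_at_top[of 2]
  show "\<forall>\<^sub>F r in at_top. exp (1/2 * r powr (1 / \<gamma>)) \<le> max_modulus entire_fn r"
  proof eventually_elim
    case (elim r)
    define x where "x = r powr (1 / \<gamma>)"
    define w where "w = complex_of_real x"
    have x: "exp (1/2 * x) \<le> exp (- base_bound) * (exp x / (x + 10)\<^sup>2)" "x > 3/2" using elim by (auto simp: x_def)
    have nw: "norm (pw w) = r" using elim x \<gamma>_pos by (simp add: norm_pw w_def x_def powr_powr)
    have E: "expfac w = of_real (exp x / (x + 10)\<^sup>2)" by (simp add: expfac_def w_def flip: exp_of_real)
    have "exp x / (x + 10)\<^sup>2 \<le> Re (1 + expfac w)" unfolding E by simp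
    then have "exp x / (x + 10)\<^sup>2 \<le> norm (1 + expfac w)" using complex_Re_le_cmod order_trans by blast
    then have "exp (- base_bound) * (exp x / (x + 10)\<^sup>2) \<le> exp (- base_bound) * norm (1 + expfac w)"
      by (intro mult_left_mono) auto
    also have "\<dots> \<le> norm (base (pw w))" using x by (intro norm_base_inside) (simp add: w_def)
    finally have "exp (1/2 * x) \<le> norm (base (pw w))" using x by linarith
    moreover have "1 \<le> (norm (pw w) / 2) ^ deg" using nw elim by (intro one_le_power) simp
    then have "1 \<le> norm (nodal (pw w))" using nodal_bounds(1)[of "pw w"] nw elim by linarith
    ultimately have "1 * exp (1/2 * x) \<le> norm (nodal (pw w)) * norm (base (pw w))"
      by (intro mult_mono) auto
    also have "\<dots> = norm (entire_fn (pw w))" by (simp add: entire_fn_def norm_mult)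
    also have "\<dots> \<le> max_modulus entire_fn r" by (rule norm_le_max_modulus[OF holomorphic_entire_fn nw])
    finally show ?case by (simp add: x_def)
  qed
  \<comment> \<open>The polynomial and the constants are absorbed by \<open>exp r\<close>, and
    \<open>exp r \<le> exp (r powr (1 / \<gamma>))\<close> because \<open>1 / \<gamma> > 1\<close>;
    hence the constant 2 in the exponent.\<close>
  have "((\<lambda>r. 2 ^ (deg + 1) * exp base_bound * (r ^ deg / exp r)) \<longlongrightarrow> 2 ^ (deg + 1) * exp base_bound * 0) at_top"
    by (intro tendsto_intros tendsto_power_div_exp_0)
  then have "\<forall>\<^sub>F r in at_top. 2 ^ (deg + 1) * exp base_bound * (r ^ deg / exp r) < 1"
    by (rule order_tendstoD) simp
  with eventually_ge_at_top[of 1]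
  show "\<forall>\<^sub>F r in at_top. max_modulus entire_fn r \<le> exp (2 * r powr (1 / \<gamma>))"
  proof eventually_elim
    case (elim r)
    show ?case
    proof (rule max_modulus_le)
      fix z :: complex assume z: "norm z = r"
      have "norm (entire_fn z) \<le> (2 * r) ^ deg * (2 * exp base_bound * exp (r powr (1 / \<gamma>)))"
        unfolding entire_fn_def norm_mult using nodal_bounds(2)[of z] norm_base_le[of z] z elim by (intro mult_mono) auto
      also have "\<dots> = (2 ^ (deg + 1) * exp base_bound * (r ^ deg / exp r)) * (exp r * exp (r powr (1 / \<gamma>)))"
        by (simp add: power_mult_distrib)
      also have "\<dots> \<le> 1 * (exp (r powr (1 / \<gamma>)) * exp (r powr (1 / \<gamma>)))"
      proof (intro mult_mono)
        have "r powr 1 \<le> r powr (1 / \<gamma>)" using elim \<gamma>_pos \<gamma>_less by (intro powr_mono) auto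
        then show "exp r \<le> exp (r powr (1 / \<gamma>))" using elim by simp
      qed (use elim in auto)
      finally show "norm (entire_fn z) \<le> exp (2 * r powr (1 / \<gamma>))" by (simp flip: exp_add)
    qed (use elim in simp)
  qed
qed (use \<gamma>_pos in auto)

end

theorem theorem1p2:
  fixes \<gamma> :: real
  assumes "0 < \<gamma>" and "\<gamma> < 1"
  shows "\<exists>F :: complex \<Rightarrow> complex. \<exists>\<theta>0 :: real.
           F holomorphic_on UNIV \<and>
           entire_order F = ereal (1 / \<gamma>) \<and>
           (\<forall>t. F t = 0 \<longrightarrow> deriv F t \<noteq> 0) \<and>
           (\<forall>t. F t = 0 \<longrightarrow> (\<exists>r \<phi>. 0 < r \<and> \<theta>0 < \<phi> \<and> \<phi> < \<theta>0 + pi * \<gamma> \<and>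
                                   t = complex_of_real r * exp (\<i> * complex_of_real \<phi>))) \<and>
           (\<lambda>t. 1 / norm (deriv F t)) summable_on {t. F t = 0} \<and>
           (\<forall>z. F z \<noteq> 0 \<longrightarrow>
              ((\<lambda>t. 1 / (deriv F t * (z - t))) has_sum (1 / F z)) {t. F t = 0})"
proof -
  interpret sector \<gamma> by unfold_locales (fact assms)+
  show ?thesis
    using holomorphic_entire_fn entire_order_entire_fn entire_fn_simple_zeros entire_fn_zeros_in_sector summable_inverse_deriv_entire_fn
      entire_fn_partial_fractions
    by (intro exI[of _ entire_fn] exI[of _ "- pi * \<gamma> / 2"]) blast
qed

end
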